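(* Let $n\ge 2$, let $P^{(0)}$ and $P^{(1)}$ be Borel probability measures on $\mathbb{R}^{n-1}$, and let $\varphi:\Delta_n\to\mathbb{R}$ be a smooth exponentially concave function such that the Euclidean Hessian of $e^{\varphi}$ is strictly negative definite everywhere on $\Delta_n$. Let $f=\varphi+\psi$ (a $c$-concave function of the exponential coordinate $\theta\in\mathbb{R}^{n-1}$) and suppose that $F^{(1)}:=\nabla^c f$ is an optimal transport map for $(P^{(0)},P^{(1)})$ with cost $c(\theta,\phi)=\psi(\theta-\phi)$. Let $\boldsymbol\pi^{(1)}:\Delta_n\to\Delta_n$ be the portfolio map generated by $\varphi^{(1)}:=\varphi$. For $t\in[0,1]$ define the portfolio map $\boldsymbol\pi^{(t)}=(1-t)\left(\frac1n,\dots,\frac1n\right)+t\,\boldsymbol\pi^{(1)}$ and the flow $(t,\theta)\mapsto\phi^{(t)}(\theta)\in\mathbb{R}^{n-1}$ by $$\phi_i^{(t)}(\theta)=\theta_i-\log\frac{\boldsymbol\pi_i^{(t)}(\theta)}{\boldsymbol\pi_n^{(t)}(\theta)},\qquad 1\le i\le n-1 .$$ (i) For each $t\in[0,1]$, the portfolio map $\boldsymbol\pi^{(t)}$ is generated by the exponentially concave function $$\varphi^{(t)}(p)=(1-t)\sum_{i=1}^n\frac1n\log p_i+t\,\varphi(p),\qquad p\in\Delta_n.$$ (ii) For each $t\in[0,1]$, let $f^{(t)}=\varphi^{(t)}+\psi$ and $F^{(t)}=\nabla^c f^{(t)}$. If $\theta$ is distributed according to $P^{(0)}$, then $\phi^{(t)}(\theta)$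 is distributed according to $P^{(t)}:=(F^{(t)})_{\#}P^{(0)}$. Moreover, $F^{(t)}$ is an optimal transport map for the transport problem for $(P^{(0)},P^{(t)})$ with cost $c$. (iii) Endow $\Delta_n$ with the geometric structure induced by the L-divergence of $\varphi$, and assume further that $F^{(1)}=\nabla^c f:\mathbb{R}^{n-1}\to\mathbb{R}^{n-1}$ is surjective. For each fixed $\theta\in\mathbb{R}^{n-1}$, consider the curve in $\Delta_n$ whose dual coordinate at time $t$ is $\phi^{(t)}(\theta)$, $t\in[0,1]$. Then the trace of this curve is (the trace of) the dual geodesic joining the points with dual coordinates $\theta$ and $\phi^{(1)}(\theta)$.
   Context: $\Delta_n=\{p\in\mathbb{R}^n: p_i>0,\ \sum_{i=1}^n p_i=1\}$; $\nabla\varphi(p)\cdot v$ is the directional derivative along $v\in\mathbb{R}^n$ with $\sum_iv_i=0$; definiteness of the Hessian is with respect to nonzero such $v$. $\varphi$ is exponentially concave if $e^\varphi$ is concave. $\psi(x)=\log(1+\sum_{i=1}^{n-1}e^{x_i})$ on $\mathbb{R}^{n-1}$ and $c(\theta,\phi)=\psi(\theta-\phi)$. Exponential (primal) coordinate of $p\in\Delta_n$: $\theta_i=\log(p_i/p_n)$, $1\le i\le n-1$. Functions on $\Delta_n$ are also written as functions of $\theta\in\mathbb{R}^{n-1}$ through this bijection. A portfolio map $\boldsymbol\pi:\Delta_n\to\overline\Delta_n$ (closure of $\Delta_n$) is generated by an exponentially concave $\varphi$ if $\sum_{i=1}^n\boldsymbol\pi_i(p)\frac{q_i}{p_i}\ge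 e^{\varphi(q)-\varphi(p)}$ for all $p,q\in\Delta_n$; for differentiable $\varphi$ necessarily $\boldsymbol\pi_i(p)=p_i(1+\nabla\varphi(p)\cdot(e^{(i)}-p))$. $c$-transform: $f^*(\phi)=\inf_\theta(c(\theta,\phi)-f(\theta))$; $f$ is $c$-concave if $f(\theta)=\inf_\phi(c(\theta,\phi)-h(\phi))$ for some $h:\mathbb{R}^{n-1}\to\mathbb{R}\cup\{-\infty\}$; $\nabla^cf(\theta)$ is the unique $\phi$ with $f(\theta)+f^*(\phi)=c(\theta,\phi)$. If $f(\theta)=\varphi(\theta)+\psi(\theta)$, where $\varphi$ is a smooth exponentially concave function on $\Delta_n$ (written in the exponential coordinate $\theta$) such that the Euclidean Hessian of $e^{\varphi}$ is strictly negative definite everywhere on $\Delta_n$, and $\boldsymbol\pi$ is the portfolio map generated by $\varphi$, then $\nabla^cf(\theta)=\big(\theta_i-\log\frac{\boldsymbol\pi_i(\theta)}{\boldsymbol\pi_n(\theta)}\big)_{1\le i\le n-1}$. Optimal transport: for Borel probability measures $P,Q$ on $\mathbb{R}^{n-1}$, minimize $\mathbb{E}_R[c(\theta,\phi)]$ over couplings $R$ of $(P,Q)$. A measurable map $F$ is an optimal transport map for $(P,Q)$ if $F_\#P=Q$ and the law of $(\theta,F(\theta))$, $\theta\sim P$, is an optimal coupling. Dual coordinate of a point of $\Delta_n$ with primal coordinate $\theta$: $\phi=\nabla^cf(\theta)$, where $f=\varphi+\psi$; this is a diffeomorphism from $\mathbb{R}^{n-1}$ onto its (open) range. L-divergence: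 $T(q\mid p)=\log(1+\nabla\varphi(p)\cdot(q-p))-(\varphi(q)-\varphi(p))$. Induced structure in coordinates $\xi$: $g_{ij}=-\partial_{\xi_i}\partial_{\xi'_j}T(\xi\mid\xi')|_{\xi=\xi'}$, dual connection $\Gamma^*_{ijk}=-\partial_{\xi_k}\partial_{\xi'_i}\partial_{\xi'_j}T(\xi\mid\xi')|_{\xi=\xi'}$, $\Gamma_{ij}^{*k}=\sum_m\Gamma^*_{ijm}g^{mk}$. A dual geodesic is a smooth curve with $\ddot\xi_k+\sum_{i,j}\Gamma_{ij}^{*k}\dot\xi_i\dot\xi_j=0$ for all $k$. The curves $t\mapsto\phi^{(t)}(\theta)$ are the minimizers, among smooth curves $\gamma:[0,1]\to\mathbb{R}^{n-1}$ from $\theta$ to $\phi^{(1)}(\theta)$, of the action $\int_0^1-\log\big(\frac1n+\frac{d}{dt}e^{-\psi(\gamma(0)-\gamma(t))}\big)dt$ given by the linear interpolation of portfolios $\boldsymbol\pi^{(t)}=(1-t)\left(\frac1n,\dots,\frac1n\right)+t\,\boldsymbol\pi^{(1)}$. *)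

theory Defs
  imports "HOL-Probability.Probability"
begin

text \<open>
  The index set {1, ..., n} with n \<ge> 2 is the type \<open>'m option\<close>: \<open>Some i\<close> for \<open>i :: 'm\<close> are the
  first n - 1 indices and \<open>None\<close> is the index n. So R^(n-1) is \<open>real ^ 'm\<close>, R^n is
  \<open>real ^ 'm option\<close>, and n = CARD('m) + 1.
\<close>

text \<open>
  The same definition serves for the simplex (relatively open in its affine hull) and for a compact
  interval (one-sided derivatives at the ends). On the simplex \<open>f' x\<close> is determined only on vectors
  tangent to the simplex, hence the existential quantifier.
\<close>
primrec Ck_on :: "nat \<Rightarrow> 'a::real_normed_vector set \<Rightarrow> ('a \<Rightarrow> 'b::real_normed_vector) \<Rightarrow> bool" where
  "Ck_on 0 S f \<longleftrightarrow> continuous_on S f"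
| "Ck_on (Suc k) S f \<longleftrightarrow>
     (\<exists>f'. (\<forall>x\<in>S. (f has_derivative f' x) (at x within S)) \<and> (\<forall>v. Ck_on k S (\<lambda>x. f' x v)))"

definition smooth_on :: "'a::real_normed_vector set \<Rightarrow> ('a \<Rightarrow> 'b::real_normed_vector) \<Rightarrow> bool" where
  "smooth_on S f \<longleftrightarrow> (\<forall>k. Ck_on k S f)"

definition dir_deriv :: "('a::real_vector \<Rightarrow> real) \<Rightarrow> 'a \<Rightarrow> 'a \<Rightarrow> real" where
  "dir_deriv f p v = deriv (\<lambda>s. f (p + s *\<^sub>R v)) 0"

definition partial :: "'m::finite \<Rightarrow> (real ^ 'm \<Rightarrow> real) \<Rightarrow> real ^ 'm \<Rightarrow> real" where
  "partial i F x = dir_deriv F x (axis i 1)"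

definition prob_simplex :: "(real ^ 'n::finite) set" where
  "prob_simplex = {p. (\<forall>i. p $ i > 0) \<and> (\<Sum>i\<in>UNIV. p $ i) = 1}"

definition exp_concave :: "(real ^ 'n::finite \<Rightarrow> real) \<Rightarrow> bool" where
  "exp_concave \<phi> \<longleftrightarrow> concave_on prob_simplex (\<lambda>p. exp (\<phi> p))"

definition hessian_neg_def :: "(real ^ 'n::finite \<Rightarrow> real) \<Rightarrow> bool" where
  "hessian_neg_def u \<longleftrightarrow>
     (\<forall>p\<in>prob_simplex. \<forall>v. v \<noteq> 0 \<and> (\<Sum>i\<in>UNIV. v $ i) = 0 \<longrightarrow>
        dir_deriv (\<lambda>q. dir_deriv u q v) p v < 0)"

definition generates :: "(real ^ 'n::finite \<Rightarrow> real) \<Rightarrow> (real ^ 'n \<Rightarrow> real ^ 'n) \<Rightarrow> bool" where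
  "generates \<phi> \<pi> \<longleftrightarrow>
     exp_concave \<phi> \<and>
     (\<forall>p\<in>prob_simplex. \<pi> p \<in> closure prob_simplex) \<and>
     (\<forall>p\<in>prob_simplex. \<forall>q\<in>prob_simplex.
        (\<Sum>i\<in>UNIV. \<pi> p $ i * (q $ i / p $ i)) \<ge> exp (\<phi> q - \<phi> p))"

definition expo_coord :: "real ^ 'm option \<Rightarrow> real ^ 'm::finite" where
  "expo_coord p = (\<chi> i. ln (p $ Some i / p $ None))"

definition expo_point :: "real ^ 'm::finite \<Rightarrow> real ^ 'm option" where
  "expo_point \<theta> =
     (\<chi> j. (case j of None \<Rightarrow> 1 | Some i \<Rightarrow> exp (\<theta> $ i)) / (1 + (\<Sum>i\<in>UNIV. exp (\<theta> $ i))))"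

lemma sum_UNIV_option:
  fixes g :: "'m::finite option \<Rightarrow> real"
  shows "(\<Sum>j\<in>UNIV. g j) = g None + (\<Sum>i\<in>UNIV. g (Some i))"
  by (simp add: UNIV_option_conv sum.reindex)

lemma bij_betw_expo_coord:
  "bij_betw expo_coord prob_simplex (UNIV :: (real ^ 'm::finite) set)"
  and the_inv_into_expo_coord:
  "the_inv_into prob_simplex expo_coord = (expo_point :: real ^ 'm \<Rightarrow> _)"
proof -
  have pos: "1 + (\<Sum>i\<in>UNIV. exp (\<theta> $ i)) > 0" for \<theta> :: "real ^ 'm"
    by (intro add_pos_nonneg sum_nonneg) auto
  have inS: "expo_point \<theta> \<in> prob_simplex" for \<theta> :: "real ^ 'm"
    using pos[of \<theta>]
    by (auto simp: prob_simplex_def expo_point_def sum_UNIV_option add_divide_distrib[symmetric]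
        sum_divide_distrib[symmetric] split: option.split)
  have 1: "expo_coord (expo_point \<theta>) = \<theta>" for \<theta> :: "real ^ 'm"
    using pos[of \<theta>] by (simp add: expo_coord_def expo_point_def vec_eq_iff)
  have 2: "expo_point (expo_coord p) = p" if p: "p \<in> prob_simplex" for p :: "real ^ 'm option"
  proof -
    have pp: "p $ j > 0" for j using p by (simp add: prob_simplex_def)
    have s: "p $ None + (\<Sum>i\<in>UNIV. p $ Some i) = 1"
      using p by (simp add: prob_simplex_def sum_UNIV_option)
    have e: "exp (expo_coord p $ i) = p $ Some i / p $ None" for i
      using pp by (simp add: expo_coord_def)
    have "1 + (\<Sum>i\<in>UNIV. exp (expo_coord p $ i)) = 1 / p $ None"
      using s pp[of None] by (simp add: e sum_divide_distrib[symmetric] field_simps)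
    then show ?thesis
      using pp[of None] by (auto simp: expo_point_def vec_eq_iff e split: option.split)
  qed
  show b: "bij_betw expo_coord prob_simplex (UNIV :: (real ^ 'm::finite) set)"
    by (rule bij_betwI[where g = expo_point]) (auto simp: inS 1 2)
  show "the_inv_into prob_simplex expo_coord = (expo_point :: real ^ 'm \<Rightarrow> _)"
    by (intro ext the_inv_into_f_eq) (use b inS 1 in \<open>auto simp: bij_betw_def\<close>)
qed

definition \<psi> :: "real ^ 'm::finite \<Rightarrow> real" where
  "\<psi> x = ln (1 + (\<Sum>i\<in>UNIV. exp (x $ i)))"

definition cost :: "real ^ 'm::finite \<Rightarrow> real ^ 'm \<Rightarrow> real" where
  "cost \<theta> \<eta> = \<psi> (\<theta> - \<eta>)"

definition c_transform :: "(real ^ 'm::finite \<Rightarrow> real) \<Rightarrow> real ^ 'm \<Rightarrow> ereal" where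
  "c_transform f \<eta> = (INF \<theta>. ereal (cost \<theta> \<eta> - f \<theta>))"

definition c_concave :: "(real ^ 'm::finite \<Rightarrow> real) \<Rightarrow> bool" where
  "c_concave f \<longleftrightarrow>
     (\<exists>h. (\<forall>\<eta>. h \<eta> \<noteq> \<infinity>) \<and> (\<forall>\<theta>. ereal (f \<theta>) = (INF \<eta>. ereal (cost \<theta> \<eta>) - h \<eta>)))"

definition is_c_gradient :: "(real ^ 'm::finite \<Rightarrow> real) \<Rightarrow> real ^ 'm \<Rightarrow> real ^ 'm \<Rightarrow> bool" where
  "is_c_gradient f \<theta> \<eta> \<longleftrightarrow> ereal (f \<theta>) + c_transform f \<eta> = ereal (cost \<theta> \<eta>)"

definition c_gradient :: "(real ^ 'm::finite \<Rightarrow> real) \<Rightarrow> real ^ 'm \<Rightarrow> real ^ 'm" where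
  "c_gradient f \<theta> = (THE \<eta>. is_c_gradient f \<theta> \<eta>)"

definition potential :: "(real ^ 'm option \<Rightarrow> real) \<Rightarrow> real ^ 'm::finite \<Rightarrow> real" where
  "potential \<phi> \<theta> = \<phi> (expo_point \<theta>) + \<psi> \<theta>"

definition coupling ::
    "(real ^ 'm::finite) measure \<Rightarrow> (real ^ 'm) measure \<Rightarrow> ((real ^ 'm) \<times> (real ^ 'm)) measure \<Rightarrow> bool" where
  "coupling P Q R \<longleftrightarrow>
     sets R = sets (borel \<Otimes>\<^sub>M borel) \<and> distr R borel fst = P \<and> distr R borel snd = Q"

text \<open>The cost is positive, so its expectation always exists in \<open>[0, \<infinity>]\<close>.\<close>
definition expected_cost :: "((real ^ 'm::finite) \<times> (real ^ 'm)) measure \<Rightarrow> ennreal" where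
  "expected_cost R = (\<integral>\<^sup>+ z. ennreal (cost (fst z) (snd z)) \<partial>R)"

definition optimal_coupling ::
    "(real ^ 'm::finite) measure \<Rightarrow> (real ^ 'm) measure \<Rightarrow> ((real ^ 'm) \<times> (real ^ 'm)) measure \<Rightarrow> bool" where
  "optimal_coupling P Q R \<longleftrightarrow>
     coupling P Q R \<and> (\<forall>R'. coupling P Q R' \<longrightarrow> expected_cost R \<le> expected_cost R')"

definition optimal_transport_map ::
    "(real ^ 'm::finite) measure \<Rightarrow> (real ^ 'm) measure \<Rightarrow> (real ^ 'm \<Rightarrow> real ^ 'm) \<Rightarrow> bool" where
  "optimal_transport_map P Q F \<longleftrightarrow>
     F \<in> borel_measurable borel \<and> distr P borel F = Q \<and>
     optimal_coupling P Q (distr P (borel \<Otimes>\<^sub>M borel) (\<lambda>\<theta>. (\<theta>, F \<theta>)))"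

definition div_metric :: "(real ^ 'm \<Rightarrow> real ^ 'm \<Rightarrow> real) \<Rightarrow> real ^ 'm \<Rightarrow> real ^ 'm ^ 'm::finite" where
  "div_metric D x = (\<chi> i j. - partial i (\<lambda>\<xi>. partial j (\<lambda>\<xi>'. D \<xi> \<xi>') x) x)"

definition dual_christoffel_lower ::
    "(real ^ 'm \<Rightarrow> real ^ 'm \<Rightarrow> real) \<Rightarrow> real ^ 'm \<Rightarrow> 'm::finite \<Rightarrow> 'm \<Rightarrow> 'm \<Rightarrow> real" where
  "dual_christoffel_lower D x i j k =
     - partial k (\<lambda>\<xi>. partial i (\<lambda>\<xi>'. partial j (\<lambda>\<xi>''. D \<xi> \<xi>'') \<xi>') x) x"

definition dual_christoffel ::
    "(real ^ 'm \<Rightarrow> real ^ 'm \<Rightarrow> real) \<Rightarrow> real ^ 'm \<Rightarrow> 'm::finite \<Rightarrow> 'm \<Rightarrow> 'm \<Rightarrow> real" where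
  "dual_christoffel D x i j k =
     (\<Sum>m\<in>UNIV. dual_christoffel_lower D x i j m * matrix_inv (div_metric D x) $ m $ k)"

definition dual_geodesic_coord ::
    "(real ^ 'm \<Rightarrow> real ^ 'm \<Rightarrow> real) \<Rightarrow> (real \<Rightarrow> real ^ 'm::finite) \<Rightarrow> bool" where
  "dual_geodesic_coord D \<xi> \<longleftrightarrow>
     smooth_on {0..1} \<xi> \<and>
     (let \<xi>' = (\<lambda>t. vector_derivative \<xi> (at t within {0..1}));
          \<xi>'' = (\<lambda>t. vector_derivative \<xi>' (at t within {0..1}))
      in \<forall>t\<in>{0..1}. \<forall>k.
           \<xi>'' t $ k + (\<Sum>i\<in>UNIV. \<Sum>j\<in>UNIV. dual_christoffel D (\<xi> t) i j k * \<xi>' t $ i * \<xi>' t $ j) = 0)"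

definition L_div :: "(real ^ 'n::finite \<Rightarrow> real) \<Rightarrow> real ^ 'n \<Rightarrow> real ^ 'n \<Rightarrow> real" where
  "L_div \<phi> q p = ln (1 + dir_deriv \<phi> p (q - p)) - (\<phi> q - \<phi> p)"

text \<open>
  Dual geodesics of the L-divergence, parametrised by [0, 1]. The geodesic equation does not depend
  on the coordinate system; it is written in the exponential coordinate.
\<close>
definition dual_geodesic ::
    "(real ^ 'm::finite option \<Rightarrow> real) \<Rightarrow> (real \<Rightarrow> real ^ 'm option) \<Rightarrow> bool" where
  "dual_geodesic \<phi> \<gamma> \<longleftrightarrow>
     (\<forall>t\<in>{0..1}. \<gamma> t \<in> prob_simplex) \<and>
     dual_geodesic_coord (\<lambda>\<xi> \<xi>'. L_div \<phi> (expo_point \<xi>) (expo_point \<xi>')) (\<lambda>t. expo_coord (\<gamma> t))"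

definition dual_coord :: "(real ^ 'm::finite option \<Rightarrow> real) \<Rightarrow> real ^ 'm option \<Rightarrow> real ^ 'm" where
  "dual_coord \<phi> p = c_gradient (potential \<phi>) (expo_coord p)"

definition dual_point :: "(real ^ 'm::finite option \<Rightarrow> real) \<Rightarrow> real ^ 'm \<Rightarrow> real ^ 'm option" where
  "dual_point \<phi> = the_inv_into prob_simplex (dual_coord \<phi>)"

definition portfolio_interp :: "(real ^ 'n::finite \<Rightarrow> real ^ 'n) \<Rightarrow> real \<Rightarrow> real ^ 'n \<Rightarrow> real ^ 'n" where
  "portfolio_interp \<pi> t p = (1 - t) *\<^sub>R (\<chi> i. 1 / real CARD('n)) + t *\<^sub>R \<pi> p"

definition phi_interp :: "(real ^ 'n::finite \<Rightarrow> real) \<Rightarrow> real \<Rightarrow> real ^ 'n \<Rightarrow> real" where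
  "phi_interp \<phi> t p = (1 - t) * (\<Sum>i\<in>UNIV. 1 / real CARD('n) * ln (p $ i)) + t * \<phi> p"

definition flow ::
    "(real ^ 'm::finite option \<Rightarrow> real ^ 'm option) \<Rightarrow> real \<Rightarrow> real ^ 'm \<Rightarrow> real ^ 'm" where
  "flow \<pi> t \<theta> =
     (\<chi> i. \<theta> $ i - ln (portfolio_interp \<pi> t (expo_point \<theta>) $ Some i /
                      portfolio_interp \<pi> t (expo_point \<theta>) $ None))"

end

theory Submission
  imports Defs
begin

text \<open>
  Everything happens in the exponential coordinate \<open>\<theta>\<close>. A portfolio map \<open>\<pi>\<close> is generated by \<open>\<phi>\<close>
  precisely when \<open>\<theta> - expo_coord (\<pi> \<theta>)\<close> is a \<open>c\<close>-gradient at \<open>\<theta>\<close> of the potential \<open>f = \<phi> + \<psi>\<close>: the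
  inequality between growth of \<open>exp \<circ> \<phi>\<close> and portfolio value is, after taking logarithms, the
  minimality that defines the \<open>c\<close>-gradient (\<open>portfolio_value_eq\<close>, \<open>generates_is_c_gradient\<close>). Such a
  \<open>c\<close>-gradient is unique because the gradient of \<open>\<psi>\<close> is injective.

  Interpolation of portfolios preserves generation by Jensen's inequality (\<open>generates_interp\<close>), so the
  flow at time \<open>t\<close> is the \<open>c\<close>-gradient of the interpolated potential. A map that is a
  \<open>c\<close>-gradient everywhere transports optimally, since the potential and its \<open>c\<close>-transform form a
  dual certificate. No expected cost is known to be finite, and the comparison goes through
  truncations of the two dual functions (\<open>expected_cost_le_if_dual\<close>).

  For the geodesics, the L-divergence is the gap in the duality inequality (\<open>L_div_expo\<close>):
  up to terms in one variable it is \<open>ln (1 + \<Sum>\<^sub>a W\<^sub>a(y) exp x\<^sub>a)\<close>, where \<open>W = exp (- dual)\<close> is the dual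
  coordinate in multiplicative form. Differentiating this expression shows that a curve is a dual
  geodesic iff its acceleration in the coordinate \<open>W\<close> is a certain multiple of its velocity
  (\<open>geodesic_equation_iff\<close>). That multiple is a logarithmic derivative along the curve, so the equation
  integrates: the velocity is a positive function, \<open>speed\<close>, times a constant vector
  (\<open>dual_geodesic_coord_iff\<close>). Thus every dual geodesic traces a segment in the coordinate \<open>W\<close>, and
  conversely every segment in the range of \<open>W\<close> has a parametrisation as a dual geodesic. The
  strict negativity of the Hessian enters through the injectivity of \<open>W\<close> and of its derivative.
  Finally the flow also traces a segment in the coordinate \<open>W\<close>, because \<open>W\<close> is, up to fixed
  factors, the projectivisation of the portfolio, which is interpolated linearly (\<open>mult_coord_flow\<close>).
\<close>

section \<open>Calculus of \<open>C\<^sup>k\<close> maps\<close>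

lemma Ck_on_SucI:
  assumes "\<And>x. x \<in> S \<Longrightarrow> (f has_derivative f' x) (at x within S)" and "\<And>v. Ck_on k S (\<lambda>x. f' x v)"
  shows "Ck_on (Suc k) S f"
  using assms by auto

lemma Ck_on_cong:
  assumes "\<And>x. x \<in> S \<Longrightarrow> f x = g x"
  shows "Ck_on k S f \<longleftrightarrow> Ck_on k S g"
proof (cases k)
  case 0
  then show ?thesis using assms by (simp cong: continuous_on_cong)
next
  case (Suc k')
  have "(f has_derivative F) (at x within S) \<longleftrightarrow> (g has_derivative F) (at x within S)"
    if "x \<in> S" for x F
    using has_derivative_transform[of x S g f] has_derivative_transform[of x S f g] assms that by auto
  then show ?thesis using Suc by simp
qed

lemma Ck_on_imp_continuous_on: "Ck_on k S f \<Longrightarrow> continuous_on S f"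
  by (cases k) (auto simp: continuous_on_eq_continuous_within intro: has_derivative_continuous)

lemma Ck_on_decrease: "Ck_on (Suc k) S f \<Longrightarrow> Ck_on k S f"
proof (induction k arbitrary: f)
  case 0
  then show ?case using Ck_on_imp_continuous_on[of 1 S f] by simp
next
  case (Suc k)
  then obtain f' where f': "\<And>x. x \<in> S \<Longrightarrow> (f has_derivative f' x) (at x within S)"
    and k: "\<And>v. Ck_on (Suc k) S (\<lambda>x. f' x v)"
    by (subst (asm) Ck_on.simps) blast
  show ?case by (rule Ck_on_SucI[OF f' Suc.IH[OF k]])
qed

lemma Ck_on_subset: "Ck_on k S f \<Longrightarrow> T \<subseteq> S \<Longrightarrow> Ck_on k T f"
proof (induction k arbitrary: f)
  case 0
  then show ?case by (auto intro: continuous_on_subset)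
next
  case (Suc k)
  then obtain f' where "\<And>x. x \<in> S \<Longrightarrow> (f has_derivative f' x) (at x within S)"
    and "\<And>v. Ck_on k S (\<lambda>x. f' x v)" by auto
  with Suc show ?case by (intro Ck_on_SucI[where f' = f']) (auto intro: has_derivative_subset)
qed

lemma Ck_on_const: "Ck_on k S (\<lambda>x. c)"
  by (induction k arbitrary: c) (auto intro!: exI[of _ "\<lambda>x v. 0"])

lemma Ck_on_bounded_linear:
  assumes "bounded_linear f"
  shows "Ck_on k S f"
proof (cases k)
  case 0
  then show ?thesis by (simp add: linear_continuous_on assms)
next
  case (Suc k')
  show ?thesis unfolding Suc
    by (rule Ck_on_SucI[OF bounded_linear_imp_has_derivative[OF assms] Ck_on_const])
qed

lemma Ck_on_add: "Ck_on k S f \<Longrightarrow> Ck_on k S g \<Longrightarrow> Ck_on k S (\<lambda>x. f x + g x)"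
proof (induction k arbitrary: f g)
  case 0
  then show ?case by (auto intro: continuous_on_add)
next
  case (Suc k)
  obtain f' where f: "\<And>x. x \<in> S \<Longrightarrow> (f has_derivative f' x) (at x within S)"
    "\<And>v. Ck_on k S (\<lambda>x. f' x v)" using Suc.prems by auto
  obtain g' where g: "\<And>x. x \<in> S \<Longrightarrow> (g has_derivative g' x) (at x within S)"
    "\<And>v. Ck_on k S (\<lambda>x. g' x v)" using Suc.prems by auto
  show ?case
    using f g by (intro Ck_on_SucI[where f' = "\<lambda>x v. f' x v + g' x v"] Suc.IH has_derivative_add)
qed

lemma Ck_on_sum: "(\<And>i. i \<in> I \<Longrightarrow> Ck_on k S (f i)) \<Longrightarrow> Ck_on k S (\<lambda>x. \<Sum>i\<in>I. f i x)"
  by (induction I rule: infinite_finite_induct) (auto intro: Ck_on_const Ck_on_add)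

lemma Ck_on_bilinear:
  assumes B: "bounded_bilinear B"
  shows "Ck_on k S f \<Longrightarrow> Ck_on k S g \<Longrightarrow> Ck_on k S (\<lambda>x. B (f x) (g x))"
proof (induction k arbitrary: f g)
  case 0
  then show ?case by (auto intro: bounded_bilinear.continuous_on[OF B])
next
  case (Suc k)
  obtain f' where f: "\<And>x. x \<in> S \<Longrightarrow> (f has_derivative f' x) (at x within S)"
    "\<And>v. Ck_on k S (\<lambda>x. f' x v)" using Suc.prems by auto
  obtain g' where g: "\<And>x. x \<in> S \<Longrightarrow> (g has_derivative g' x) (at x within S)"
    "\<And>v. Ck_on k S (\<lambda>x. g' x v)" using Suc.prems by auto
  have "Ck_on k S f" "Ck_on k S g" using Suc.prems by (blast intro: Ck_on_decrease)+
  then show ?case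
    using f g by (intro Ck_on_SucI[where f' = "\<lambda>x v. B (f x) (g' x v) + B (f' x v) (g x)"]
        Ck_on_add Suc.IH bounded_bilinear.FDERIV[OF B])
qed

lemmas Ck_on_mult = Ck_on_bilinear[OF bounded_bilinear_mult]
lemmas Ck_on_scaleR = Ck_on_bilinear[OF bounded_bilinear_scaleR]

lemma Ck_on_minus: "Ck_on k S f \<Longrightarrow> Ck_on k S (\<lambda>x. - f x)"
  using Ck_on_scaleR[OF Ck_on_const[of k S "-1"]] by simp

lemma Ck_on_diff: "Ck_on k S f \<Longrightarrow> Ck_on k S g \<Longrightarrow> Ck_on k S (\<lambda>x. f x - g x)"
  using Ck_on_add[OF _ Ck_on_minus] by fastforce

lemma Ck_on_prod:
  fixes f :: "'i \<Rightarrow> 'a::real_normed_vector \<Rightarrow> real"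
  shows "(\<And>i. i \<in> I \<Longrightarrow> Ck_on k S (f i)) \<Longrightarrow> Ck_on k S (\<lambda>x. \<Prod>i\<in>I. f i x)"
  by (induction I rule: infinite_finite_induct) (auto intro: Ck_on_const Ck_on_mult)

text \<open>
  The chain rule expresses the derivative of \<open>g \<circ> f\<close> in a direction as a combination of the finitely
  many derivatives of \<open>g\<close> along a basis, so that the induction on the order stays within compositions.
\<close>
lemma Ck_on_compose:
  fixes f :: "'a::real_normed_vector \<Rightarrow> 'b::euclidean_space" and g :: "'b \<Rightarrow> 'c::real_normed_vector"
  shows "Ck_on k S f \<Longrightarrow> Ck_on k T g \<Longrightarrow> f ` S \<subseteq> T \<Longrightarrow> Ck_on k S (\<lambda>x. g (f x))"
proof (induction k arbitrary: g)
  case 0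
  then show ?case by (auto intro: continuous_on_compose2)
next
  case (Suc k)
  obtain f' where f: "\<And>x. x \<in> S \<Longrightarrow> (f has_derivative f' x) (at x within S)"
    "\<And>v. Ck_on k S (\<lambda>x. f' x v)" using Suc.prems by auto
  obtain g' where g: "\<And>x. x \<in> T \<Longrightarrow> (g has_derivative g' x) (at x within T)"
    "\<And>v. Ck_on k T (\<lambda>x. g' x v)" using Suc.prems(2) by auto
  have fk: "Ck_on k S f" using Suc.prems by (blast intro: Ck_on_decrease)
  define G where "G x v = (\<Sum>b\<in>Basis. (f' x v \<bullet> b) *\<^sub>R g' (f x) b)" for x v
  have der: "((\<lambda>x. g (f x)) has_derivative G x) (at x within S)" if x: "x \<in> S" for x
  proof -
    have fx: "f x \<in> T" using x Suc.prems by auto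
    have "(g has_derivative g' (f x)) (at (f x) within f ` S)"
      using g(1)[OF fx] Suc.prems(3) by (rule has_derivative_subset)
    from diff_chain_within[OF f(1)[OF x] this]
    have chain: "((\<lambda>x. g (f x)) has_derivative (\<lambda>v. g' (f x) (f' x v))) (at x within S)"
      by (simp add: o_def)
    have rep: "g' (f x) u = (\<Sum>b\<in>Basis. (u \<bullet> b) *\<^sub>R g' (f x) b)" for u
    proof -
      have l: "linear (g' (f x))"
        using g(1)[OF fx] by (auto dest: has_derivative_bounded_linear bounded_linear.linear)
      have "g' (f x) u = g' (f x) (\<Sum>b\<in>Basis. (u \<bullet> b) *\<^sub>R b)" by (simp add: euclidean_representation)
      then show ?thesis using l by (simp add: linear_sum linear_cmul)
    qed
    have "(\<lambda>v. g' (f x) (f' x v)) = G x"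
      unfolding G_def by (intro ext rep)
    with chain show ?thesis by simp
  qed
  have "Ck_on k S (\<lambda>x. G x v)" for v
    unfolding G_def
    by (rule Ck_on_sum, rule Ck_on_scaleR[OF Ck_on_bilinear[OF bounded_bilinear_inner f(2) Ck_on_const]],
        rule Suc.IH[OF fk g(2) Suc.prems(3)])
  with der show ?case by (rule Ck_on_SucI)
qed

lemma Ck_on_inverse_real: "Ck_on k (- {0}) (inverse :: real \<Rightarrow> real)"
proof (induction k)
  case 0
  then show ?case by (auto intro!: continuous_intros)
next
  case (Suc k)
  show ?case
  proof (rule Ck_on_SucI[where f' = "\<lambda>x v. - (inverse x * v * inverse x)"])
    show "(inverse has_derivative (\<lambda>v. - (inverse x * v * inverse x))) (at x within - {0})"
      if "x \<in> - {0}" for x :: real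
      using that has_derivative_inverse'[of x] by auto
  qed (intro Ck_on_minus Ck_on_mult Ck_on_const Suc.IH)
qed

lemma Ck_on_exp_real: "Ck_on k S (exp :: real \<Rightarrow> real)"
proof (induction k)
  case 0
  then show ?case by (auto intro!: continuous_intros)
next
  case (Suc k)
  show ?case
    by (rule Ck_on_SucI[where f' = "\<lambda>x v. exp x * v"])
      (auto intro!: derivative_eq_intros Ck_on_mult Ck_on_const Suc.IH)
qed

lemma Ck_on_ln_real: "Ck_on k {0<..} (ln :: real \<Rightarrow> real)"
proof (cases k)
  case 0
  then show ?thesis by (auto intro!: continuous_intros)
next
  case (Suc k')
  have "Ck_on k' {0<..} (inverse :: real \<Rightarrow> real)"
    by (rule Ck_on_subset[OF Ck_on_inverse_real]) auto
  then show ?thesis unfolding Suc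
    by (intro Ck_on_SucI[where f' = "\<lambda>x v. inverse x * v"])
      (auto intro!: derivative_eq_intros Ck_on_mult Ck_on_const)
qed

lemma Ck_on_exp: "Ck_on k S f \<Longrightarrow> Ck_on k S (\<lambda>x. exp (f x :: real))"
  using Ck_on_compose[OF _ Ck_on_exp_real subset_UNIV] .

lemma Ck_on_ln: "Ck_on k S f \<Longrightarrow> (\<And>x. x \<in> S \<Longrightarrow> f x > 0) \<Longrightarrow> Ck_on k S (\<lambda>x. ln (f x :: real))"
  using Ck_on_compose[OF _ Ck_on_ln_real, of k S f] by auto

lemma Ck_on_divide:
  fixes f g :: "'a::real_normed_vector \<Rightarrow> real"
  assumes "Ck_on k S f" "Ck_on k S g" "\<And>x. x \<in> S \<Longrightarrow> g x \<noteq> 0"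
  shows "Ck_on k S (\<lambda>x. f x / g x)"
proof -
  have "Ck_on k S (\<lambda>x. inverse (g x))"
    by (rule Ck_on_compose[OF assms(2) Ck_on_inverse_real]) (use assms in auto)
  then show ?thesis unfolding divide_inverse by (rule Ck_on_mult[OF assms(1)])
qed

lemma Ck_on_vec_lambda:
  fixes f :: "'i::finite \<Rightarrow> 'a::real_normed_vector \<Rightarrow> real"
  assumes "\<And>i. Ck_on k S (f i)"
  shows "Ck_on k S (\<lambda>x. \<chi> i. f i x)"
proof -
  have "(\<lambda>x. \<chi> i. f i x) = (\<lambda>x. \<Sum>i\<in>UNIV. f i x *\<^sub>R axis i 1)"
    by (auto simp: vec_eq_iff axis_def if_distrib cong: if_cong)
  moreover have "Ck_on k S (\<lambda>x. \<Sum>i\<in>UNIV. f i x *\<^sub>R (axis i 1 :: real ^ 'i))"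
    by (rule Ck_on_sum, rule Ck_on_scaleR[OF assms Ck_on_const])
  ultimately show ?thesis by simp
qed

lemma Ck_on_nth: "Ck_on k S (\<lambda>x :: real ^ 'm::finite. x $ i)"
  by (rule Ck_on_bounded_linear[OF bounded_linear_vec_nth])

lemma Ck_on_det:
  fixes A :: "'a::real_normed_vector \<Rightarrow> real ^ 'm ^ 'm::finite"
  assumes "\<And>i j. Ck_on k S (\<lambda>x. A x $ i $ j)"
  shows "Ck_on k S (\<lambda>x. det (A x))"
  unfolding det_def
  by (rule Ck_on_sum, rule Ck_on_mult[OF Ck_on_const], rule Ck_on_prod, rule assms)

section \<open>Partial derivatives of smooth functions\<close>

lemma line_derivative:
  assumes "(h has_derivative h') (at x)"
  shows "((\<lambda>r. h (x + r *\<^sub>R v)) has_real_derivative h' v) (at 0)"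
proof -
  have "((\<lambda>r. x + r *\<^sub>R v) has_derivative (\<lambda>r. r *\<^sub>R v)) (at (0::real))"
    by (auto intro!: derivative_eq_intros)
  then have "((\<lambda>r. h (x + r *\<^sub>R v)) has_derivative (\<lambda>r. h' (r *\<^sub>R v))) (at 0)"
    by (rule has_derivative_compose) (use assms in simp)
  moreover have "h' (r *\<^sub>R v) = h' v * r" for r
    using has_derivative_bounded_linear[OF assms] by (simp add: linear_cmul bounded_linear.linear)
  ultimately show ?thesis by (simp add: has_field_derivative_def)
qed

lemma partial_eq_line:
  "((\<lambda>r. h (x + r *\<^sub>R axis i 1)) has_real_derivative d) (at 0) \<Longrightarrow> partial i h x = d"
  by (simp add: partial_def dir_deriv_def DERIV_imp_deriv)

lemma partial_eq: "(h has_derivative h') (at x) \<Longrightarrow> partial i h x = h' (axis i 1)"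
  by (rule partial_eq_line[OF line_derivative])

lemma linear_axis_sum:
  fixes F :: "real ^ 'm::finite \<Rightarrow> real"
  assumes "linear F"
  shows "F v = (\<Sum>i\<in>UNIV. v $ i * F (axis i 1))"
proof -
  have "F v = F (\<Sum>i\<in>UNIV. v $ i *\<^sub>R axis i 1)"
    by (simp add: basis_expansion[of v, unfolded scalar_mult_eq_scaleR])
  then show ?thesis using assms by (simp add: linear_sum linear_cmul)
qed

lemma has_derivative_partial:
  fixes h :: "real ^ 'm::finite \<Rightarrow> real"
  assumes "Ck_on (Suc k) UNIV h"
  shows "(h has_derivative (\<lambda>v. \<Sum>i\<in>UNIV. v $ i * partial i h x)) (at x)"
proof -
  obtain h' where h': "\<And>x. (h has_derivative h' x) (at x)" using assms by auto
  have "h' x = (\<lambda>v. \<Sum>i\<in>UNIV. v $ i * h' x (axis i 1))"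
    using h' by (intro ext linear_axis_sum bounded_linear.linear has_derivative_bounded_linear)
  then show ?thesis using h'[of x] by (simp add: partial_eq[OF h'])
qed

lemma Ck_on_partial:
  fixes h :: "real ^ 'm::finite \<Rightarrow> real"
  assumes "Ck_on (Suc k) UNIV h"
  shows "Ck_on k UNIV (partial i h)"
proof -
  obtain h' where h': "\<And>x. (h has_derivative h' x) (at x)" and "\<And>v. Ck_on k UNIV (\<lambda>x. h' x v)"
    using assms by auto
  then show ?thesis using Ck_on_cong[of UNIV "partial i h"] by (simp add: partial_eq[OF h'])
qed

lemma smooth_on_D: "smooth_on S f \<Longrightarrow> Ck_on k S f"
  by (simp add: smooth_on_def)

lemma smooth_on_partial: "smooth_on UNIV h \<Longrightarrow> smooth_on UNIV (partial i h)"
  by (auto simp: smooth_on_def intro: Ck_on_partial)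

lemma smooth_on_has_derivative:
  fixes h :: "real ^ 'm::finite \<Rightarrow> real"
  shows "smooth_on UNIV h \<Longrightarrow> (h has_derivative (\<lambda>v. \<Sum>i\<in>UNIV. v $ i * partial i h x)) (at x)"
  by (rule has_derivative_partial[OF smooth_on_D])

lemma smooth_on_partial_line:
  fixes h :: "real ^ 'm::finite \<Rightarrow> real"
  assumes "smooth_on UNIV h"
  shows "((\<lambda>s. h (x + s *\<^sub>R axis i 1)) has_real_derivative partial i h (x + s *\<^sub>R axis i 1)) (at s)"
proof -
  have "((\<lambda>s. x + s *\<^sub>R axis i 1) has_derivative (\<lambda>s. s *\<^sub>R axis i 1)) (at s)"
    by (auto intro!: derivative_eq_intros)
  from has_derivative_compose[OF this smooth_on_has_derivative[OF assms]]
  have "((\<lambda>s. h (x + s *\<^sub>R axis i 1)) has_derivative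
      (\<lambda>r. \<Sum>j\<in>UNIV. (r *\<^sub>R axis i 1) $ j * partial j h (x + s *\<^sub>R axis i 1))) (at s)" .
  moreover have "(\<Sum>j\<in>UNIV. (r *\<^sub>R axis i 1) $ j * P j) = P i * r" for r and P :: "'m \<Rightarrow> real"
    by (simp add: axis_def if_distrib if_distribR mult.commute cong: if_cong)
  ultimately show ?thesis by (simp only: has_field_derivative_def)
qed

text \<open>
  Both mixed second derivatives are limits of the quotient of the double difference of \<open>h\<close> over
  small squares by their area: the mean value theorem, applied to the variables in either order,
  produces a value of either mixed derivative at a point of the square.
\<close>
lemma partial_commute:
  fixes h :: "real ^ 'm::finite \<Rightarrow> real"
  assumes h: "smooth_on UNIV h"
  shows "partial i (partial j h) x = partial j (partial i h) x"
proof -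
  define P where "P i j s t = partial i (partial j h) (x + s *\<^sub>R axis i 1 + t *\<^sub>R axis j 1)"
    for i j :: 'm and s t
  define \<Delta> where "\<Delta> r = h (x + r *\<^sub>R axis i 1 + r *\<^sub>R axis j 1) - h (x + r *\<^sub>R axis i 1)
      - h (x + r *\<^sub>R axis j 1) + h x" for r :: real
  have mean: "\<exists>s t. 0 < s \<and> s < r \<and> 0 < t \<and> t < r \<and>
      h (x + r *\<^sub>R axis i 1 + r *\<^sub>R axis j 1) - h (x + r *\<^sub>R axis i 1)
        - h (x + r *\<^sub>R axis j 1) + h x = r * r * P j i t s"
    if r: "0 < r" for r :: real and i j
  proof -
    define u where "u s = h ((x + r *\<^sub>R axis j 1) + s *\<^sub>R axis i 1) - h (x + s *\<^sub>R axis i 1)" for s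
    have "\<exists>s. 0 < s \<and> s < r \<and> u r - u 0 = (r - 0) *
        (partial i h ((x + r *\<^sub>R axis j 1) + s *\<^sub>R axis i 1) - partial i h (x + s *\<^sub>R axis i 1))"
      unfolding u_def by (rule MVT2[OF r]) (intro DERIV_diff smooth_on_partial_line h)
    then obtain s where s: "0 < s" "s < r" and us: "u r - u 0 = r *
        (partial i h ((x + s *\<^sub>R axis i 1) + r *\<^sub>R axis j 1) - partial i h (x + s *\<^sub>R axis i 1))"
      by (auto simp: algebra_simps)
    have "\<exists>t. 0 < t \<and> t < r \<and> partial i h ((x + s *\<^sub>R axis i 1) + r *\<^sub>R axis j 1)
        - partial i h ((x + s *\<^sub>R axis i 1) + 0 *\<^sub>R axis j 1)
        = (r - 0) * partial j (partial i h) ((x + s *\<^sub>R axis i 1) + t *\<^sub>R axis j 1)"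
      by (rule MVT2[OF r]) (rule smooth_on_partial_line[OF smooth_on_partial[OF h]])
    then obtain t where t: "0 < t" "t < r" "partial i h ((x + s *\<^sub>R axis i 1) + r *\<^sub>R axis j 1)
        - partial i h (x + s *\<^sub>R axis i 1) = r * P j i t s"
      by (auto simp: P_def algebra_simps)
    have "h (x + r *\<^sub>R axis i 1 + r *\<^sub>R axis j 1) - h (x + r *\<^sub>R axis i 1)
        - h (x + r *\<^sub>R axis j 1) + h x = u r - u 0"
      by (simp add: u_def algebra_simps)
    then show ?thesis using s t us by auto
  qed
  have "\<forall>n. \<exists>s t. 0 < s \<and> s < inverse (real (Suc n)) \<and> 0 < t \<and> t < inverse (real (Suc n)) \<and>
      \<Delta> (inverse (real (Suc n))) = inverse (real (Suc n)) * inverse (real (Suc n)) * P j i t s"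
    unfolding \<Delta>_def by (intro allI mean) simp
  then obtain s t where st: "\<And>n. 0 < s n \<and> s n < inverse (real (Suc n)) \<and> 0 < t n \<and>
      t n < inverse (real (Suc n)) \<and>
      \<Delta> (inverse (real (Suc n))) = inverse (real (Suc n)) * inverse (real (Suc n)) * P j i (t n) (s n)"
    by metis
  have "\<forall>n. \<exists>s t. 0 < s \<and> s < inverse (real (Suc n)) \<and> 0 < t \<and> t < inverse (real (Suc n)) \<and>
      \<Delta> (inverse (real (Suc n))) = inverse (real (Suc n)) * inverse (real (Suc n)) * P i j t s"
    using mean[of "inverse (real (Suc n))" j i for n] unfolding \<Delta>_def
    by (auto simp: algebra_simps)
  then obtain s' t' where st': "\<And>n. 0 < s' n \<and> s' n < inverse (real (Suc n)) \<and> 0 < t' n \<and>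
      t' n < inverse (real (Suc n)) \<and>
      \<Delta> (inverse (real (Suc n))) = inverse (real (Suc n)) * inverse (real (Suc n)) * P i j (t' n) (s' n)"
    by metis
  have eq: "P j i (t n) (s n) = P i j (t' n) (s' n)" for n
    using st[of n] st'[of n] by auto
  have to0: "a \<longlonglongrightarrow> 0" if "\<And>n. 0 < a n \<and> a n < inverse (real (Suc n))" for a :: "nat \<Rightarrow> real"
    by (rule real_tendsto_sandwich[OF _ _ tendsto_const LIMSEQ_inverse_real_of_nat])
      (use that in \<open>auto simp: less_imp_le intro!: always_eventually\<close>)
  have lim: "(\<lambda>n. P i j (a n) (b n)) \<longlonglongrightarrow> P i j 0 0" if "a \<longlonglongrightarrow> 0" "b \<longlonglongrightarrow> 0" for a b i j
  proof -
    have "smooth_on UNIV (partial i (partial j h))" by (intro smooth_on_partial h)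
    then have "isCont (partial i (partial j h)) y" for y
      using Ck_on_imp_continuous_on[OF smooth_on_D[of UNIV _ 0]]
      by (metis continuous_on_eq_continuous_at open_UNIV UNIV_I)
    then show ?thesis unfolding P_def
      by (rule isCont_tendsto_compose) (intro tendsto_intros that)
  qed
  have "(\<lambda>n. P j i (t n) (s n)) \<longlonglongrightarrow> P j i 0 0" using st by (intro lim to0) auto
  moreover have "(\<lambda>n. P j i (t n) (s n)) \<longlonglongrightarrow> P i j 0 0"
    unfolding eq using st' by (intro lim to0) auto
  ultimately have "P j i 0 0 = P i j 0 0" by (rule LIMSEQ_unique)
  then show ?thesis by (simp add: P_def)
qed

section \<open>The exponential coordinate\<close>

lemma one_plus_sum_exp_pos: "0 < 1 + (\<Sum>i\<in>UNIV. exp (x $ i :: real))"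
  by (intro add_pos_nonneg sum_nonneg) auto

lemma exp_psi: "exp (\<psi> x) = 1 + (\<Sum>i\<in>UNIV. exp (x $ i))"
  by (simp add: \<psi>_def one_plus_sum_exp_pos)

lemma psi_nonneg: "0 \<le> \<psi> x"
  by (simp add: \<psi>_def sum_nonneg)

lemma expo_point_None: "expo_point x $ None = exp (- \<psi> x)"
  by (simp add: expo_point_def exp_minus exp_psi inverse_eq_divide)

lemma expo_point_Some: "expo_point x $ Some i = exp (x $ i - \<psi> x)"
  by (simp add: expo_point_def exp_diff exp_psi)

lemma prob_simplex_pos: "p \<in> prob_simplex \<Longrightarrow> 0 < p $ i"
  by (simp add: prob_simplex_def)

lemma prob_simplex_sum: "p \<in> prob_simplex \<Longrightarrow> (\<Sum>i\<in>UNIV. p $ i) = 1"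
  by (simp add: prob_simplex_def)

lemma expo_point_in_simplex [simp]: "expo_point x \<in> prob_simplex"
  using bij_betw_the_inv_into[OF bij_betw_expo_coord]
  by (auto simp: the_inv_into_expo_coord bij_betw_def)

lemma expo_coord_expo_point [simp]: "expo_coord (expo_point x) = x"
  using f_the_inv_into_f_bij_betw[OF bij_betw_expo_coord]
  by (metis UNIV_I the_inv_into_expo_coord)

lemma expo_point_expo_coord: "p \<in> prob_simplex \<Longrightarrow> expo_point (expo_coord p) = p"
  using the_inv_into_f_f[OF bij_betw_imp_inj_on[OF bij_betw_expo_coord]]
  by (metis the_inv_into_expo_coord)

lemma expo_point_inject: "expo_point x = expo_point y \<longleftrightarrow> x = y"
  by (metis expo_coord_expo_point)

lemma expo_point_eqI:
  assumes "\<And>i. expo_point x $ Some i = expo_point y $ Some i"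
  shows "x = y"
proof -
  have "expo_point x $ None = expo_point y $ None"
    using prob_simplex_sum[OF expo_point_in_simplex, of x] prob_simplex_sum[OF expo_point_in_simplex, of y]
    by (simp add: sum_UNIV_option assms)
  then have "expo_point x = expo_point y"
    using assms by (metis not_Some_eq vec_eq_iff)
  then show ?thesis by (simp add: expo_point_inject)
qed

lemma Ck_on_psi: "Ck_on k S \<psi>"
  unfolding \<psi>_def[abs_def]
  by (intro Ck_on_ln Ck_on_add Ck_on_const Ck_on_sum Ck_on_exp Ck_on_nth one_plus_sum_exp_pos)

lemma Ck_on_expo_point: "Ck_on k S (expo_point :: real ^ 'm::finite \<Rightarrow> _)"
proof -
  have "Ck_on k S (\<lambda>x :: real ^ 'm. case j of None \<Rightarrow> exp (- \<psi> x) | Some i \<Rightarrow> exp (x $ i - \<psi> x))" for j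
    by (cases j) (auto intro!: Ck_on_exp Ck_on_diff Ck_on_minus Ck_on_nth Ck_on_psi)
  then have "Ck_on k S (\<lambda>x :: real ^ 'm. \<chi> j. case j of None \<Rightarrow> exp (- \<psi> x) | Some i \<Rightarrow> exp (x $ i - \<psi> x))"
    by (rule Ck_on_vec_lambda)
  also have "(\<lambda>x :: real ^ 'm. \<chi> j. case j of None \<Rightarrow> exp (- \<psi> x) | Some i \<Rightarrow> exp (x $ i - \<psi> x)) = expo_point"
    by (auto simp: vec_eq_iff expo_point_None expo_point_Some split: option.split)
  finally show ?thesis .
qed

lemma psi_has_derivative:
  "(\<psi> has_derivative (\<lambda>v. \<Sum>i\<in>UNIV. v $ i * expo_point x $ Some i)) (at x)"
proof -
  have "(\<psi> has_derivative (\<lambda>v. (\<Sum>i\<in>UNIV. exp (x $ i) * v $ i) / (1 + (\<Sum>i\<in>UNIV. exp (x $ i))))) (at x)"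
    unfolding \<psi>_def[abs_def]
    by (auto intro!: derivative_eq_intros bounded_linear_imp_has_derivative[OF bounded_linear_vec_nth]
        simp: one_plus_sum_exp_pos divide_inverse mult.commute)
  moreover have "(\<Sum>i\<in>UNIV. exp (x $ i) * v $ i) / (1 + (\<Sum>i\<in>UNIV. exp (x $ i)))
      = (\<Sum>i\<in>UNIV. v $ i * expo_point x $ Some i)" for v
    by (simp add: expo_point_def sum_divide_distrib mult.commute)
  ultimately show ?thesis by simp
qed

lemma potential_expo_coord:
  "p \<in> prob_simplex \<Longrightarrow> \<phi> p = potential \<phi> (expo_coord p) - \<psi> (expo_coord p)"
  by (simp add: potential_def expo_point_expo_coord)

lemma smooth_potential:
  assumes "smooth_on prob_simplex \<phi>"
  shows "smooth_on UNIV (potential \<phi>)"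
  unfolding smooth_on_def
proof
  fix k
  have "Ck_on k UNIV (\<lambda>x. \<phi> (expo_point x))"
    by (rule Ck_on_compose[OF Ck_on_expo_point smooth_on_D[OF assms]]) auto
  then show "Ck_on k UNIV (potential \<phi>)"
    unfolding potential_def[abs_def] by (rule Ck_on_add[OF _ Ck_on_psi])
qed

text \<open>
  The dictionary between portfolios and the cost. The left-hand side is the relative value of the
  portfolio \<open>r\<close> after the market has moved from \<open>x\<close> to \<open>y\<close>; writing \<open>r\<close> itself as a point
  \<open>expo_point z\<close> turns this sum of exponentials into \<open>\<psi>\<close>.
\<close>
lemma portfolio_value_eq:
  fixes x y :: "real ^ 'm::finite"
  assumes r: "r \<in> prob_simplex"
  shows "(\<Sum>j\<in>UNIV. r $ j * (expo_point y $ j / expo_point x $ j))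
    = exp (cost y (x - expo_coord r) - \<psi> y - (cost x (x - expo_coord r) - \<psi> x))"
proof -
  define z where "z = expo_coord r"
  have r: "r = expo_point z" using assms by (simp add: z_def expo_point_expo_coord)
  have "(\<Sum>j\<in>UNIV. r $ j * (expo_point y $ j / expo_point x $ j))
    = exp (\<psi> x - \<psi> y - \<psi> z) + (\<Sum>i\<in>UNIV. exp (\<psi> x - \<psi> y - \<psi> z) * exp ((y - (x - z)) $ i))"
    unfolding sum_UNIV_option r expo_point_None expo_point_Some
    by (simp add: exp_diff[symmetric] exp_add[symmetric] algebra_simps)
  also have "\<dots> = exp (\<psi> x - \<psi> y - \<psi> z) * exp (\<psi> (y - (x - z)))"
    by (simp add: exp_psi sum_distrib_left algebra_simps)
  finally show ?thesis by (simp add: exp_add[symmetric] cost_def z_def algebra_simps)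
qed

section \<open>The \<open>c\<close>-gradient\<close>

lemma is_c_gradient_iff: "is_c_gradient f \<theta> \<eta> \<longleftrightarrow> (\<forall>\<theta>'. cost \<theta> \<eta> - f \<theta> \<le> cost \<theta>' \<eta> - f \<theta>')"
proof -
  have "is_c_gradient f \<theta> \<eta> \<longleftrightarrow> c_transform f \<eta> = ereal (cost \<theta> \<eta> - f \<theta>)"
    unfolding is_c_gradient_def by (cases "c_transform f \<eta>") auto
  also have "\<dots> \<longleftrightarrow> ereal (cost \<theta> \<eta> - f \<theta>) \<le> c_transform f \<eta>"
    unfolding c_transform_def by (auto intro!: antisym INF_lower2)
  also have "\<dots> \<longleftrightarrow> (\<forall>\<theta>'. cost \<theta> \<eta> - f \<theta> \<le> cost \<theta>' \<eta> - f \<theta>')"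
    unfolding c_transform_def by (simp add: le_INF_iff)
  finally show ?thesis .
qed

text \<open>
  At a \<open>c\<close>-gradient \<open>\<eta>\<close> the point \<open>\<theta>\<close> minimises \<open>cost \<theta> \<eta> - f \<theta>\<close>, and the gradient of \<open>\<psi>\<close> is the
  vector of the entries with index \<open>Some i\<close> of \<open>expo_point\<close>. Since this gradient map is injective,
  \<open>\<eta>\<close> can be recovered from the derivative of \<open>f\<close>.
\<close>
lemma is_c_gradient_first_order:
  assumes g: "is_c_gradient f \<theta> \<eta>" and f: "(f has_derivative f') (at \<theta>)"
  shows "f' v = (\<Sum>i\<in>UNIV. v $ i * expo_point (\<theta> - \<eta>) $ Some i)"
proof -
  have "((\<lambda>\<theta>. cost \<theta> \<eta>) has_derivative (\<lambda>v. \<Sum>i\<in>UNIV. v $ i * expo_point (\<theta> - \<eta>) $ Some i)) (at \<theta>)"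
    unfolding cost_def
    by (rule has_derivative_compose[of "\<lambda>\<theta>. \<theta> - \<eta>" "\<lambda>v. v", OF _ psi_has_derivative])
      (auto intro!: derivative_eq_intros)
  from differential_zero_maxmin[OF UNIV_I open_UNIV has_derivative_diff[OF this f]]
  have "(\<lambda>v. (\<Sum>i\<in>UNIV. v $ i * expo_point (\<theta> - \<eta>) $ Some i) - f' v) = (\<lambda>v. 0)"
    using g by (simp add: is_c_gradient_iff)
  then show ?thesis by (auto dest: fun_cong[of _ _ v])
qed

lemma is_c_gradient_unique:
  assumes g: "is_c_gradient f \<theta> \<eta>" "is_c_gradient f \<theta> \<eta>'" and f: "(f has_derivative f') (at \<theta>)"
  shows "\<eta> = \<eta>'"
proof -
  have *: "f' (axis i 1) = expo_point (\<theta> - \<zeta>) $ Some i" if "is_c_gradient f \<theta> \<zeta>" for \<zeta> i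
    using is_c_gradient_first_order[OF that f, of "axis i 1"]
    by (simp add: axis_def if_distrib if_distribR cong: if_cong)
  have "\<theta> - \<eta> = \<theta> - \<eta>'"
    using *[OF g(1)] *[OF g(2)] by (intro expo_point_eqI) simp
  then show ?thesis by simp
qed

lemma c_gradient_eq:
  assumes "is_c_gradient f \<theta> \<eta>" and "(f has_derivative f') (at \<theta>)"
  shows "(\<exists>!\<eta>. is_c_gradient f \<theta> \<eta>) \<and> c_gradient f \<theta> = \<eta>"
  using assms is_c_gradient_unique[OF _ _ assms(2)] unfolding c_gradient_def by blast

text \<open>
  The representation as an infimum holds with the \<open>c\<close>-transform of \<open>f\<close>; a \<open>c\<close>-gradient at \<open>\<theta>\<close> is a
  point where the infimum is attained.
\<close>
lemma c_concave_if_c_gradient: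
  assumes "\<And>\<theta>. \<exists>\<eta>. is_c_gradient f \<theta> \<eta>"
  shows "c_concave f"
  unfolding c_concave_def
proof (intro exI conjI allI)
  have le: "c_transform f \<eta> \<le> ereal (cost \<theta> \<eta> - f \<theta>)" for \<theta> \<eta>
    unfolding c_transform_def by (rule INF_lower) simp
  show "c_transform f \<eta> \<noteq> \<infinity>" for \<eta> using le[of \<eta> 0] by auto
  fix \<theta>
  obtain \<eta> where \<eta>: "is_c_gradient f \<theta> \<eta>" using assms by blast
  show "ereal (f \<theta>) = (INF \<eta>. ereal (cost \<theta> \<eta>) - c_transform f \<eta>)"
  proof (rule antisym)
    show "ereal (f \<theta>) \<le> (INF \<eta>. ereal (cost \<theta> \<eta>) - c_transform f \<eta>)"
    proof (rule INF_greatest)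
      show "ereal (f \<theta>) \<le> ereal (cost \<theta> \<eta>) - c_transform f \<eta>" for \<eta>
        using le[of \<eta> \<theta>] by (cases "c_transform f \<eta>") auto
    qed
    have "ereal (cost \<theta> \<eta>) - c_transform f \<eta> = ereal (f \<theta>)"
      using \<eta> unfolding is_c_gradient_def by (cases "c_transform f \<eta>") auto
    then show "(INF \<eta>. ereal (cost \<theta> \<eta>) - c_transform f \<eta>) \<le> ereal (f \<theta>)"
      by (intro INF_lower2[of \<eta>]) auto
  qed
qed

section \<open>Generated portfolios and their interpolation\<close>

lemma convex_prob_simplex: "convex (prob_simplex :: (real ^ 'n::finite) set)"
proof (rule convexI)
  fix x y :: "real ^ 'n" and u v :: real
  assume x: "x \<in> prob_simplex" and y: "y \<in> prob_simplex" and uv: "0 \<le> u" "0 \<le> v" "u + v = 1"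
  have "0 < u * x $ i + v * y $ i" for i
  proof (cases "u = 0")
    case True
    then show ?thesis using uv prob_simplex_pos[OF y] by simp
  next
    case False
    then show ?thesis using uv prob_simplex_pos[OF x, of i] prob_simplex_pos[OF y, of i]
      by (intro add_pos_nonneg) (auto intro: less_imp_le)
  qed
  then show "u *\<^sub>R x + v *\<^sub>R y \<in> prob_simplex"
    using x y uv by (simp add: prob_simplex_def sum.distrib sum_distrib_left[symmetric])
qed

text \<open>
  The inequality in the definition of a generated portfolio map exhibits \<open>exp \<circ> \<phi>\<close> as an infimum of
  affine functions, hence it contains exponential concavity.
\<close>
lemma exp_concave_if_supported:
  assumes \<pi>: "\<And>p. p \<in> prob_simplex \<Longrightarrow> \<pi> p \<in> prob_simplex"
    and le: "\<And>p q. p \<in> prob_simplex \<Longrightarrow> q \<in> prob_simplex \<Longrightarrow>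
      exp (\<phi> q - \<phi> p) \<le> (\<Sum>i\<in>UNIV. \<pi> p $ i * (q $ i / p $ i))"
  shows "exp_concave \<phi>"
  unfolding exp_concave_def concave_on_iff
proof (intro conjI ballI allI impI convex_prob_simplex)
  fix x y :: "real ^ 'a" and u v :: real
  assume x: "x \<in> prob_simplex" and y: "y \<in> prob_simplex" and uv: "0 \<le> u" "0 \<le> v" "u + v = 1"
  define z where "z = u *\<^sub>R x + v *\<^sub>R y"
  define L where "L q = (\<Sum>i\<in>UNIV. \<pi> z $ i * (q $ i / z $ i))" for q
  have z: "z \<in> prob_simplex" unfolding z_def by (rule convexD[OF convex_prob_simplex x y uv])
  have nz: "z $ i \<noteq> 0" for i using prob_simplex_pos[OF z, of i] by simp
  have "L z = (\<Sum>i\<in>UNIV. \<pi> z $ i)"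
    unfolding L_def by (simp add: nz)
  then have "L z = 1" using prob_simplex_sum[OF \<pi>[OF z]] by simp
  moreover have "L z = u * L x + v * L y"
    unfolding L_def by (subst (2) z_def)
      (simp add: sum_distrib_left sum.distrib[symmetric] algebra_simps add_divide_distrib)
  moreover have "exp (\<phi> q) \<le> exp (\<phi> z) * L q" if "q \<in> prob_simplex" for q
    using le[OF z that] by (simp add: L_def exp_diff pos_divide_le_eq mult.commute)
  then have "u * exp (\<phi> x) + v * exp (\<phi> y) \<le> u * (exp (\<phi> z) * L x) + v * (exp (\<phi> z) * L y)"
    using x y uv by (intro add_mono mult_left_mono)
  moreover have "u * (exp (\<phi> z) * L x) + v * (exp (\<phi> z) * L y) = exp (\<phi> z) * (u * L x + v * L y)"
    by (simp add: algebra_simps)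
  ultimately show "u * exp (\<phi> x) + v * exp (\<phi> y) \<le> exp (\<phi> (u *\<^sub>R x + v *\<^sub>R y))"
    by (simp flip: z_def)
qed

lemma portfolio_interp_in_simplex:
  fixes \<pi> :: "real ^ 'n::finite \<Rightarrow> real ^ 'n"
  assumes "\<pi> p \<in> prob_simplex" "t \<in> {0..1}"
  shows "portfolio_interp \<pi> t p \<in> prob_simplex"
proof -
  have "(\<chi> i. 1 / real CARD('n) :: real ^ 'n) \<in> prob_simplex"
    by (simp add: prob_simplex_def)
  then show ?thesis unfolding portfolio_interp_def
    using assms by (intro convexD[OF convex_prob_simplex]) auto
qed

text \<open>
  Jensen's inequality for the exponential function compares the portfolio value of the interpolation
  with the growth of \<open>phi_interp\<close>; it is applied here as the tangent line \<open>1 + x \<le> exp x\<close> at the mean.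
\<close>
lemma generates_interp:
  fixes \<phi> :: "real ^ 'n::finite \<Rightarrow> real"
  assumes gen: "generates \<phi> \<pi>" and \<pi>: "\<And>p. p \<in> prob_simplex \<Longrightarrow> \<pi> p \<in> prob_simplex"
    and t: "t \<in> {0..1}"
  shows "generates (phi_interp \<phi> t) (portfolio_interp \<pi> t)"
proof -
  have "exp (phi_interp \<phi> t q - phi_interp \<phi> t p)
      \<le> (\<Sum>i\<in>UNIV. portfolio_interp \<pi> t p $ i * (q $ i / p $ i))"
    if p: "p \<in> prob_simplex" and q: "q \<in> prob_simplex" for p q
  proof -
    define m where "m = phi_interp \<phi> t q - phi_interp \<phi> t p"
    define y where "y i = ln (q $ i / p $ i)" for i
    have m: "m = (1 - t) * (\<Sum>i\<in>UNIV. 1 / real CARD('n) * y i) + t * (\<phi> q - \<phi> p)"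
      using prob_simplex_pos[OF p] prob_simplex_pos[OF q]
      by (simp add: m_def y_def phi_interp_def ln_div less_imp_neq[THEN not_sym]
          algebra_simps sum_subtractf diff_divide_distrib)
    have "exp m = exp m * ((1 - t) * (\<Sum>i\<in>UNIV. 1 / real CARD('n) * (1 + (y i - m))) + t * (1 + (\<phi> q - \<phi> p - m)))"
      using m by (simp add: sum.distrib sum_subtractf sum_divide_distrib[symmetric] algebra_simps
          add_divide_distrib diff_divide_distrib)
    also have "\<dots> \<le> exp m * ((1 - t) * (\<Sum>i\<in>UNIV. 1 / real CARD('n) * exp (y i - m)) + t * exp (\<phi> q - \<phi> p - m))"
      using t by (intro mult_left_mono add_mono sum_mono exp_ge_add_one_self) auto
    also have "\<dots> = (1 - t) * (\<Sum>i\<in>UNIV. 1 / real CARD('n) * exp (y i)) + t * exp (\<phi> q - \<phi> p)"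
      by (simp add: exp_diff sum_divide_distrib[symmetric] field_simps exp_add)
    also have "\<dots> \<le> (1 - t) * (\<Sum>i\<in>UNIV. 1 / real CARD('n) * exp (y i))
        + t * (\<Sum>i\<in>UNIV. \<pi> p $ i * (q $ i / p $ i))"
      using gen p q t unfolding generates_def by (intro add_left_mono mult_left_mono) auto
    also have "\<dots> = (\<Sum>i\<in>UNIV. portfolio_interp \<pi> t p $ i * (q $ i / p $ i))"
      using prob_simplex_pos[OF p] prob_simplex_pos[OF q]
      by (simp add: portfolio_interp_def y_def sum_distrib_left sum.distrib distrib_right mult.assoc
          del: times_divide_eq_right times_divide_eq_left)
    finally show ?thesis by (simp add: m_def)
  qed
  then show ?thesis
    unfolding generates_def using portfolio_interp_in_simplex[where \<pi> = \<pi>, OF \<pi> t] closure_subset[of prob_simplex]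
    by (auto 0 3 intro!: exp_concave_if_supported[of "portfolio_interp \<pi> t"])
qed

text \<open>
  The inequality that defines a generated portfolio map says, after taking logarithms, that the dual
  point of \<open>x\<close> is a \<open>c\<close>-gradient at \<open>x\<close>.
\<close>
lemma generates_is_c_gradient:
  assumes gen: "generates \<phi> \<pi>" and \<pi>: "\<pi> (expo_point x) \<in> prob_simplex"
  shows "is_c_gradient (potential \<phi>) x (x - expo_coord (\<pi> (expo_point x)))"
  unfolding is_c_gradient_iff
proof
  fix y
  have "exp (\<phi> (expo_point y) - \<phi> (expo_point x))
      \<le> (\<Sum>i\<in>UNIV. \<pi> (expo_point x) $ i * (expo_point y $ i / expo_point x $ i))"
    using gen by (simp add: generates_def)
  then show "cost x (x - expo_coord (\<pi> (expo_point x))) - potential \<phi> x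
      \<le> cost y (x - expo_coord (\<pi> (expo_point x))) - potential \<phi> y"
    unfolding portfolio_value_eq[OF \<pi>] by (simp add: potential_def)
qed

text \<open>
  The term \<open>\<psi>\<close> in the potential compensates the common summand \<open>- \<psi> x\<close> of the logarithms of the
  weights, so the potential of the equally weighted portfolio is a linear function.
\<close>
lemma potential_phi_interp:
  fixes x :: "real ^ 'm::finite"
  shows "potential (phi_interp \<phi> t) x
    = (1 - t) * (\<Sum>i\<in>UNIV. 1 / real CARD('m option) * x $ i) + t * potential \<phi> x"
proof -
  define N where "N = real CARD('m option)"
  have N: "N = 1 + real CARD('m)" by (simp add: N_def)
  have "(\<Sum>j\<in>UNIV. 1 / N * ln (expo_point x $ j)) = 1 / N * (- \<psi> x + (\<Sum>i\<in>UNIV. x $ i - \<psi> x))"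
    unfolding sum_UNIV_option expo_point_None expo_point_Some by (simp add: sum_divide_distrib diff_divide_distrib)
  also have "- \<psi> x + (\<Sum>i\<in>UNIV. x $ i - \<psi> x) = (\<Sum>i\<in>UNIV. x $ i) - N * \<psi> x"
    by (simp add: sum_subtractf N algebra_simps)
  also have "1 / N * ((\<Sum>i\<in>UNIV. x $ i) - N * \<psi> x) = (\<Sum>i\<in>UNIV. 1 / N * x $ i) - \<psi> x"
    using N by (simp add: sum_divide_distrib[symmetric] diff_divide_distrib)
  finally have "(\<Sum>j\<in>UNIV. 1 / real CARD('m option) * ln (expo_point x $ j))
      = (\<Sum>i\<in>UNIV. 1 / real CARD('m option) * x $ i) - \<psi> x"
    by (simp only: N_def)
  then show ?thesis
    unfolding potential_def phi_interp_def by (simp only:) (simp only: algebra_simps)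
qed

lemma flow_eq: "flow \<pi> t x = x - expo_coord (portfolio_interp \<pi> t (expo_point x))"
  by (simp add: flow_def expo_coord_def vec_eq_iff)

section \<open>Optimality from a dual certificate\<close>

lemma coupling_measurable:
  assumes "coupling P Q R"
  shows "fst \<in> R \<rightarrow>\<^sub>M borel" and "snd \<in> R \<rightarrow>\<^sub>M borel"
  using assms unfolding coupling_def by (simp_all cong: measurable_cong_sets)

lemma coupling_prob_space:
  assumes "coupling P Q R" "prob_space P"
  shows "prob_space R"
proof -
  have "prob_space (distr R borel fst)" using assms by (simp add: coupling_def)
  then show ?thesis by (rule prob_space_distrD[OF coupling_measurable(1)[OF assms(1)]])
qed

lemma integral_coupling_add:
  fixes a b :: "real ^ 'm::finite \<Rightarrow> real"
  assumes R: "coupling P Q R" and P: "prob_space P"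
    and [measurable]: "a \<in> borel_measurable borel" "b \<in> borel_measurable borel"
    and bound: "\<And>x. \<bar>a x\<bar> \<le> B" "\<And>x. \<bar>b x\<bar> \<le> B"
  shows "integrable R (\<lambda>z. a (fst z) + b (snd z))"
    and "(\<integral>z. a (fst z) + b (snd z) \<partial>R) = (\<integral>x. a x \<partial>P) + (\<integral>y. b y \<partial>Q)"
proof -
  interpret R: prob_space R by (rule coupling_prob_space[OF R P])
  note [measurable] = coupling_measurable[OF R]
  have i: "integrable R (\<lambda>z. a (fst z))" "integrable R (\<lambda>z. b (snd z))"
    using bound by (auto intro!: R.integrable_const_bound[of _ B])
  then show "integrable R (\<lambda>z. a (fst z) + b (snd z))" by simp
  have PQ: "P = distr R borel fst" "Q = distr R borel snd" using R by (simp_all add: coupling_def)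
  show "(\<integral>z. a (fst z) + b (snd z) \<partial>R) = (\<integral>x. a x \<partial>P) + (\<integral>y. b y \<partial>Q)"
    unfolding PQ using i by (simp add: integral_distr)
qed

text \<open>
  In general neither \<open>f\<close> and \<open>g\<close> nor the cost is integrable, so the two expected costs cannot be
  compared by integrating the inequality \<open>f + g \<le> c\<close>. Truncating both functions to \<open>{-n..n}\<close> makes
  their integrals depend on the marginals alone, and truncation keeps the sum below \<open>max 0 c\<close>;
  Fatou's lemma recovers the cost of \<open>R\<close> in the limit.
\<close>
lemma expected_cost_le_if_dual:
  fixes f g :: "real ^ 'm::finite \<Rightarrow> real"
  assumes R: "coupling P Q R" and R': "coupling P Q R'" and P: "prob_space P"
    and [measurable]: "f \<in> borel_measurable borel" "g \<in> borel_measurable borel"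
    and eq: "AE z in R. cost (fst z) (snd z) = f (fst z) + g (snd z)"
    and le: "AE z in R'. f (fst z) + g (snd z) \<le> cost (fst z) (snd z)"
  shows "expected_cost R \<le> expected_cost R'"
proof -
  define T where "T n a = max (- real n) (min (real n) a)" for n and a :: real
  define h where "h n z = T n (f (fst z)) + T n (g (snd z))" for n z
  have [measurable]: "T n \<in> borel_measurable borel" for n unfolding T_def by measurable
  have bound: "\<bar>T n a\<bar> \<le> real n" for n a by (auto simp: T_def)
  have nonneg: "0 \<le> T n a + T n b" if "0 \<le> a + b" for n a b using that by (auto simp: T_def)
  have upper: "T n a + T n b \<le> max 0 (a + b)" for n a b by (auto simp: T_def)
  note [measurable] = coupling_measurable[OF R] coupling_measurable[OF R']
  have int: "integrable S (h n)" "(\<integral>z. h n z \<partial>S) = (\<integral>x. T n (f x) \<partial>P) + (\<integral>y. T n (g y) \<partial>Q)"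
    if "coupling P Q S" for S n
    unfolding h_def using bound
    by (auto intro!: integral_coupling_add[OF that P, of "\<lambda>x. T n (f x)" "\<lambda>y. T n (g y)" "real n"])
  have pos: "AE z in R. 0 \<le> h n z" for n
    using eq by eventually_elim (auto simp: h_def cost_def psi_nonneg intro!: nonneg dest: sym)
  have step: "(\<integral>\<^sup>+ z. ennreal (h n z) \<partial>R) \<le> expected_cost R'" for n
  proof -
    have "(\<integral>\<^sup>+ z. ennreal (h n z) \<partial>R) = ennreal (\<integral>z. h n z \<partial>R)"
      using int(1)[OF R] pos by (rule nn_integral_eq_integral)
    also have "(\<integral>z. h n z \<partial>R) = (\<integral>z. h n z \<partial>R')" using int(2)[OF R] int(2)[OF R'] by simp
    also have "\<dots> \<le> (\<integral>z. max 0 (h n z) \<partial>R')"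
      using int(1)[OF R'] by (intro integral_mono integrable_max) auto
    also have "ennreal \<dots> = (\<integral>\<^sup>+ z. ennreal (max 0 (h n z)) \<partial>R')"
      using int(1)[OF R'] by (intro nn_integral_eq_integral[symmetric] integrable_max) auto
    also have "\<dots> \<le> expected_cost R'"
      unfolding expected_cost_def
    proof (rule nn_integral_mono_AE)
      show "AE z in R'. ennreal (max 0 (h n z)) \<le> ennreal (cost (fst z) (snd z))"
        using le
      proof eventually_elim
        case (elim z)
        have "h n z \<le> max 0 (f (fst z) + g (snd z))" unfolding h_def by (rule upper)
        also have "\<dots> \<le> cost (fst z) (snd z)" using elim by (simp add: cost_def psi_nonneg)
        finally show ?case by (intro ennreal_leI) (simp add: cost_def psi_nonneg)
      qed
    qed
    finally show ?thesis by (simp add: ennreal_leI)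
  qed
  have lim: "AE z in R. ennreal (cost (fst z) (snd z)) = liminf (\<lambda>n. ennreal (h n z))"
    using eq
  proof eventually_elim
    case (elim z)
    have T: "(\<lambda>n. T n a) \<longlonglongrightarrow> a" for a
    proof (rule tendsto_eventually)
      obtain N where "\<bar>a\<bar> \<le> real N" using real_arch_simple by blast
      then show "\<forall>\<^sub>F n in sequentially. T n a = a"
        by (intro eventually_sequentiallyI[of N]) (auto simp: T_def)
    qed
    have "(\<lambda>n. h n z) \<longlonglongrightarrow> cost (fst z) (snd z)"
      unfolding h_def elim by (intro tendsto_add T)
    then have "(\<lambda>n. ennreal (h n z)) \<longlonglongrightarrow> ennreal (cost (fst z) (snd z))" by (rule tendsto_ennrealI)
    then show ?case by (simp add: lim_imp_Liminf)
  qed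
  have "expected_cost R = (\<integral>\<^sup>+ z. liminf (\<lambda>n. ennreal (h n z)) \<partial>R)"
    unfolding expected_cost_def by (rule nn_integral_cong_AE[OF lim])
  also have "\<dots> \<le> liminf (\<lambda>n. \<integral>\<^sup>+ z. ennreal (h n z) \<partial>R)"
    by (rule nn_integral_liminf) (simp add: h_def)
  also have "\<dots> \<le> expected_cost R'"
    using step by (intro Liminf_le always_eventually) auto
  finally show ?thesis .
qed

text \<open>
  The \<open>c\<close>-transform is upper semicontinuous, as an infimum of continuous functions. This gives its
  Borel measurability although the infimum is uncountable.
\<close>
lemma open_c_transform_less: "open {\<eta>. c_transform f \<eta> < a}"
proof -
  have "{\<eta>. c_transform f \<eta> < a} = (\<Union>\<theta>. {\<eta>. ereal (cost \<theta> \<eta> - f \<theta>) < a})"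
    by (auto simp: c_transform_def INF_less_iff)
  moreover have "continuous_on UNIV (\<lambda>\<eta>. ereal (cost \<theta> \<eta> - f \<theta>))" for \<theta>
    unfolding cost_def
    by (intro continuous_on_ereal continuous_intros
        continuous_on_compose2[OF Ck_on_imp_continuous_on[OF Ck_on_psi[of 0 UNIV]]]) auto
  then have "open {\<eta>. ereal (cost \<theta> \<eta> - f \<theta>) < a}" for \<theta>
    by (intro open_Collect_less continuous_on_const)
  ultimately show ?thesis by (simp add: open_UN)
qed

lemma measurable_psi: "\<psi> \<in> borel_measurable borel"
  by (rule borel_measurable_continuous_onI[OF Ck_on_imp_continuous_on[OF Ck_on_psi]])

text \<open>
  The dual certificate is \<open>f\<close> together with its \<open>c\<close>-transform. The latter may take the value
  \<open>- \<infinity>\<close> (where \<open>real_of_ereal\<close> puts 0), but not on the range of \<open>F\<close>, hence almost nowhere with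
  respect to the second marginal of any competitor.
\<close>
lemma optimal_transport_map_if_c_gradient:
  assumes P: "prob_space P" "sets P = sets borel" and F: "F \<in> borel_measurable borel"
    and f: "f \<in> borel_measurable borel" and grad: "\<And>\<theta>. is_c_gradient f \<theta> (F \<theta>)"
  shows "optimal_transport_map P (distr P borel F) F"
  unfolding optimal_transport_map_def optimal_coupling_def
proof (intro conjI allI impI F refl)
  note [measurable] = F f
  have [measurable]: "F \<in> P \<rightarrow>\<^sub>M borel" "(\<lambda>\<theta>. (\<theta>, F \<theta>)) \<in> P \<rightarrow>\<^sub>M borel \<Otimes>\<^sub>M borel"
    using P(2) by (simp_all cong: measurable_cong_sets)
  let ?R = "distr P (borel \<Otimes>\<^sub>M borel) (\<lambda>\<theta>. (\<theta>, F \<theta>))"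
  define g where "g \<eta> = real_of_ereal (c_transform f \<eta>)" for \<eta>
  have c[measurable]: "c_transform f \<in> borel_measurable borel"
    by (rule borel_measurableI_less) (simp add: open_c_transform_less)
  have [measurable]: "g \<in> borel_measurable borel" unfolding g_def by measurable
  have fin: "c_transform f (F \<theta>) = ereal (cost \<theta> (F \<theta>) - f \<theta>)" for \<theta>
    using grad[of \<theta>] unfolding is_c_gradient_def by (cases "c_transform f (F \<theta>)") auto
  have "(\<lambda>z. cost (fst z) (snd z)) \<in> borel_measurable (borel \<Otimes>\<^sub>M borel)"
    unfolding cost_def
    by (rule measurable_compose[OF _ measurable_psi]) simp
  moreover have "(\<lambda>z. f (fst z) + g (snd z)) \<in> borel_measurable (borel \<Otimes>\<^sub>M borel)"
    by simp
  ultimately have set: "{z \<in> space (borel \<Otimes>\<^sub>M borel). cost (fst z) (snd z) = f (fst z) + g (snd z)} \<in> sets (borel \<Otimes>\<^sub>M borel)"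
    by (rule borel_measurable_eq)
  have pair: "(\<lambda>\<theta>. (\<theta>, F \<theta>)) \<in> P \<rightarrow>\<^sub>M borel \<Otimes>\<^sub>M borel" by measurable
  have eq: "AE z in ?R. cost (fst z) (snd z) = f (fst z) + g (snd z)"
    unfolding AE_distr_iff[OF pair set] by (rule AE_I2) (simp add: g_def fin)
  show R: "coupling P (distr P borel F) ?R"
    unfolding coupling_def using P(2) by (simp add: distr_distr o_def distr_id2)
  fix R' assume R': "coupling P (distr P borel F) R'"
  note [measurable] = coupling_measurable[OF R']
  have set': "{\<eta> \<in> space borel. c_transform f \<eta> \<noteq> - \<infinity>} \<in> sets borel"
    by measurable
  have FP: "F \<in> P \<rightarrow>\<^sub>M borel" by measurable
  have "AE \<eta> in distr P borel F. c_transform f \<eta> \<noteq> - \<infinity>"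
    unfolding AE_distr_iff[OF FP set'] by (rule AE_I2) (simp add: fin)
  then have "AE \<eta> in distr R' borel snd. c_transform f \<eta> \<noteq> - \<infinity>"
    using R' unfolding coupling_def by (elim conjE) (simp only:)
  then have "AE z in R'. c_transform f (snd z) \<noteq> - \<infinity>"
    unfolding AE_distr_iff[OF coupling_measurable(2)[OF R'] set'] .
  then have "AE z in R'. f (fst z) + g (snd z) \<le> cost (fst z) (snd z)"
  proof eventually_elim
    case (elim z)
    have "c_transform f (snd z) \<le> ereal (cost (fst z) (snd z) - f (fst z))"
      unfolding c_transform_def by (rule INF_lower) simp
    with elim show ?case unfolding g_def by (cases "c_transform f (snd z)") auto
  qed
  with eq show "expected_cost ?R \<le> expected_cost R'"
    by (intro expected_cost_le_if_dual[OF R R' P(1), of f g]) auto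
qed

section \<open>The dual coordinate\<close>

lemma simplex_line:
  fixes p v :: "real ^ 'n::finite"
  assumes p: "p \<in> prob_simplex" and v: "(\<Sum>i\<in>UNIV. v $ i) = 0"
  shows "\<forall>\<^sub>F s in nhds 0. p + s *\<^sub>R v \<in> prob_simplex"
proof -
  have "\<forall>\<^sub>F s in nhds 0. 0 < p $ i + s * v $ i" for i
  proof -
    have "((\<lambda>s. p $ i + s * v $ i) \<longlongrightarrow> p $ i + 0 * v $ i) (nhds 0)"
      by (intro tendsto_intros filterlim_ident)
    then show ?thesis using prob_simplex_pos[OF p, of i] by (auto dest: order_tendstoD)
  qed
  then have "\<forall>\<^sub>F s in nhds 0. \<forall>i. 0 < p $ i + s * v $ i" by (rule eventually_all_finite)
  then show ?thesis
    using p v by (simp add: prob_simplex_def sum.distrib sum_distrib_left[symmetric])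
qed

text \<open>
  Derivatives of \<open>\<phi>\<close> make sense only tangentially to the simplex. Its potential \<open>f\<close> is smooth on the
  whole coordinate space, and the regularity of all quantities below is inherited from it.
\<close>
locale generated_portfolio =
  fixes \<phi> :: "real ^ 'm::finite option \<Rightarrow> real" and \<pi> :: "real ^ 'm option \<Rightarrow> real ^ 'm option"
  assumes smooth: "smooth_on prob_simplex \<phi>"
    and generated: "generates \<phi> \<pi>"
    and interior: "p \<in> prob_simplex \<Longrightarrow> \<pi> p \<in> prob_simplex"
begin

definition dual :: "real ^ 'm \<Rightarrow> real ^ 'm" where
  "dual x = x - expo_coord (\<pi> (expo_point x))"

text \<open>
  The multiplicative form of the dual coordinate. The vector \<open>(W, 1)\<close> is proportional to
  \<open>\<pi>\<^sub>j(p) / p\<^sub>j\<close> (see \<open>portfolio_ratio\<close>), hence to the coefficients of the linear function that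
  supports \<open>exp \<circ> \<phi>\<close> at \<open>p\<close>. In this coordinate dual geodesics are straight.
\<close>
definition W :: "real ^ 'm \<Rightarrow> real ^ 'm" where
  "W x = (\<chi> a. exp (- (dual x $ a)))"

abbreviation f :: "real ^ 'm \<Rightarrow> real" where
  "f \<equiv> potential \<phi>"

lemma smooth_f: "smooth_on UNIV f"
  by (rule smooth_potential[OF smooth])

lemma is_c_gradient_dual: "is_c_gradient f x (dual x)"
  unfolding dual_def by (rule generates_is_c_gradient[OF generated interior]) simp

lemma c_gradient_f: "c_gradient f = dual"
  using c_gradient_eq[OF is_c_gradient_dual smooth_on_has_derivative[OF smooth_f]] by blast

lemma c_gradient_interp:
  assumes t: "t \<in> {0..1}"
  shows "(\<exists>!\<eta>. is_c_gradient (potential (phi_interp \<phi> t)) x \<eta>)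
    \<and> c_gradient (potential (phi_interp \<phi> t)) x = flow \<pi> t x"
    and "is_c_gradient (potential (phi_interp \<phi> t)) x (flow \<pi> t x)"
proof -
  show grad: "is_c_gradient (potential (phi_interp \<phi> t)) x (flow \<pi> t x)"
    unfolding flow_eq
    by (intro generates_is_c_gradient generates_interp[OF generated interior t]
        portfolio_interp_in_simplex interior t) auto
  have "(potential (phi_interp \<phi> t) has_derivative (\<lambda>v. (1 - t) * (\<Sum>i\<in>UNIV. 1 / real CARD('m option) * v $ i)
      + t * (\<Sum>i\<in>UNIV. v $ i * partial i f x))) (at x)"
    unfolding potential_phi_interp[abs_def]
    by (intro has_derivative_add has_derivative_mult_right has_derivative_sum
        smooth_on_has_derivative[OF smooth_f]
        bounded_linear_imp_has_derivative[OF bounded_linear_vec_nth])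
  from c_gradient_eq[OF grad this]
  show "(\<exists>!\<eta>. is_c_gradient (potential (phi_interp \<phi> t)) x \<eta>)
    \<and> c_gradient (potential (phi_interp \<phi> t)) x = flow \<pi> t x" .
qed

lemma partial_f: "partial i f x = \<pi> (expo_point x) $ Some i"
proof -
  have "partial i f x = (\<Sum>j\<in>UNIV. axis i 1 $ j * partial j f x)"
    by (simp add: axis_def if_distrib if_distribR cong: if_cong)
  also have "\<dots> = (\<Sum>j\<in>UNIV. axis i 1 $ j * expo_point (x - dual x) $ Some j)"
    by (rule is_c_gradient_first_order[OF is_c_gradient_dual smooth_on_has_derivative[OF smooth_f]])
  also have "\<dots> = expo_point (x - dual x) $ Some i"
    by (simp add: axis_def if_distrib if_distribR cong: if_cong)
  also have "expo_point (x - dual x) = \<pi> (expo_point x)"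
    by (simp add: dual_def expo_point_expo_coord interior)
  finally show ?thesis .
qed

lemma portfolio_None: "\<pi> (expo_point x) $ None = 1 - (\<Sum>i\<in>UNIV. partial i f x)"
  using prob_simplex_sum[OF interior[OF expo_point_in_simplex, of x]]
  by (simp add: sum_UNIV_option partial_f)

lemma portfolio_pos: "p \<in> prob_simplex \<Longrightarrow> 0 < \<pi> p $ j"
  by (rule prob_simplex_pos[OF interior])

lemma flow_measurable: "t \<in> {0..1} \<Longrightarrow> flow \<pi> t \<in> borel_measurable borel"
proof -
  assume t: "t \<in> {0..1}"
  define N where "N = 1 / real CARD('m option)"
  have pos: "0 < (1 - t) * N + t * \<pi> (expo_point x) $ j" for x j
    using prob_simplex_pos[OF portfolio_interp_in_simplex[where \<pi> = \<pi>, OF interior[OF expo_point_in_simplex] t]]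
    by (simp add: portfolio_interp_def N_def)
  have "Ck_on 0 UNIV (\<lambda>x. (1 - t) * N + t * \<pi> (expo_point x) $ Some i)" for i
    unfolding partial_f[symmetric]
    by (intro Ck_on_add Ck_on_mult Ck_on_const smooth_on_D[OF smooth_on_partial[OF smooth_f]])
  moreover have "Ck_on 0 UNIV (\<lambda>x. (1 - t) * N + t * \<pi> (expo_point x) $ None)"
    unfolding portfolio_None
    by (intro Ck_on_add Ck_on_diff Ck_on_sum Ck_on_mult Ck_on_const smooth_on_D[OF smooth_on_partial[OF smooth_f]])
  ultimately have "Ck_on 0 UNIV (\<lambda>x. \<chi> i. x $ i - ln (((1 - t) * N + t * \<pi> (expo_point x) $ Some i) /
      ((1 - t) * N + t * \<pi> (expo_point x) $ None)))"
    using pos by (intro Ck_on_vec_lambda Ck_on_diff Ck_on_nth Ck_on_ln Ck_on_divide)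
      (auto simp: less_imp_neq[THEN not_sym])
  also have "(\<lambda>x. \<chi> i. x $ i - ln (((1 - t) * N + t * \<pi> (expo_point x) $ Some i) /
      ((1 - t) * N + t * \<pi> (expo_point x) $ None))) = flow \<pi> t"
    by (simp add: flow_def[abs_def] portfolio_interp_def N_def)
  finally show ?thesis by (intro borel_measurable_continuous_onI) simp
qed

lemma W_pos: "0 < W x $ a"
  by (simp add: W_def)

lemma W_eq_portfolio:
  "W x $ a = exp (- (x $ a)) * (\<pi> (expo_point x) $ Some a / \<pi> (expo_point x) $ None)"
  using portfolio_pos[OF expo_point_in_simplex, of x]
  by (simp add: W_def dual_def expo_coord_def exp_diff exp_minus field_simps)

lemma smooth_W: "smooth_on UNIV (\<lambda>x. W x $ a)"
  unfolding smooth_on_def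
proof
  fix k
  have "Ck_on k UNIV (\<lambda>x. exp (- (x $ a)) * (partial a f x / (1 - (\<Sum>i\<in>UNIV. partial i f x))))"
    using portfolio_pos[OF expo_point_in_simplex, of _ None] unfolding portfolio_None
    by (intro Ck_on_mult Ck_on_exp Ck_on_minus Ck_on_nth Ck_on_divide Ck_on_diff Ck_on_sum Ck_on_const
        smooth_on_D[OF smooth_on_partial[OF smooth_f]]) (auto dest: less_imp_neq)
  then show "Ck_on k UNIV (\<lambda>x. W x $ a)"
    by (simp add: W_eq_portfolio partial_f portfolio_None)
qed

definition dW :: "'m \<Rightarrow> real ^ 'm \<Rightarrow> real ^ 'm" where
  "dW j x = (\<chi> a. partial j (\<lambda>x. W x $ a) x)"

definition ddW :: "'m \<Rightarrow> 'm \<Rightarrow> real ^ 'm \<Rightarrow> real ^ 'm" where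
  "ddW i j x = (\<chi> a. partial i (partial j (\<lambda>x. W x $ a)) x)"

lemma W_has_derivative: "((\<lambda>x. W x $ a) has_derivative (\<lambda>v. \<Sum>j\<in>UNIV. v $ j * dW j x $ a)) (at x)"
  using smooth_on_has_derivative[OF smooth_W] by (simp add: dW_def)

lemma smooth_dW: "smooth_on UNIV (\<lambda>x. dW j x $ a)"
  unfolding dW_def using smooth_on_partial[OF smooth_W] by simp

lemma dW_has_derivative:
  "((\<lambda>x. dW j x $ a) has_derivative (\<lambda>v. \<Sum>i\<in>UNIV. v $ i * ddW i j x $ a)) (at x)"
  using smooth_on_has_derivative[OF smooth_on_partial[OF smooth_W]] by (simp add: dW_def ddW_def)

lemma portfolio_ratio:
  assumes p: "p \<in> prob_simplex"
  defines "w \<equiv> W (expo_coord p)"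
  shows "\<pi> p $ None / p $ None = 1 / (p $ None + (\<Sum>a\<in>UNIV. w $ a * p $ Some a))"
    and "\<pi> p $ Some b / p $ Some b = w $ b / (p $ None + (\<Sum>a\<in>UNIV. w $ a * p $ Some a))"
proof -
  have pos: "0 < p $ j" "0 < \<pi> p $ j" for j
    using prob_simplex_pos[OF p] portfolio_pos[OF p] by auto
  have e: "exp (- (expo_coord p $ a)) = p $ None / p $ Some a" for a
    using pos by (simp add: expo_coord_def exp_minus)
  have w: "w $ a = p $ None / p $ Some a * (\<pi> p $ Some a / \<pi> p $ None)" for a
    by (simp add: w_def W_eq_portfolio expo_point_expo_coord[OF p] e)
  have "p $ None + (\<Sum>a\<in>UNIV. w $ a * p $ Some a)
      = p $ None / \<pi> p $ None * (\<pi> p $ None + (\<Sum>a\<in>UNIV. \<pi> p $ Some a))"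
    using pos[of None] by (simp add: w distrib_left sum_distrib_left)
      (intro sum.cong, auto simp: pos less_imp_neq[THEN not_sym])
  also have "\<pi> p $ None + (\<Sum>a\<in>UNIV. \<pi> p $ Some a) = 1"
    using prob_simplex_sum[OF interior[OF p]] by (simp add: sum_UNIV_option)
  finally have "p $ None + (\<Sum>a\<in>UNIV. w $ a * p $ Some a) = p $ None / \<pi> p $ None" by simp
  then show "\<pi> p $ None / p $ None = 1 / (p $ None + (\<Sum>a\<in>UNIV. w $ a * p $ Some a))"
    and "\<pi> p $ Some b / p $ Some b = w $ b / (p $ None + (\<Sum>a\<in>UNIV. w $ a * p $ Some a))"
    using pos[of None] pos[of "Some b"] by (simp_all add: w)
qed

lemma expo_coord_line_has_derivative:
  fixes q v :: "real ^ 'm option"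
  assumes "q + s *\<^sub>R v \<in> prob_simplex"
  shows "((\<lambda>s. expo_coord (q + s *\<^sub>R v)) has_derivative
    (\<lambda>r. r *\<^sub>R (\<chi> i. v $ Some i / (q + s *\<^sub>R v) $ Some i - v $ None / (q + s *\<^sub>R v) $ None))) (at s)"
proof -
  have pos: "0 < q $ j + s * v $ j" for j using prob_simplex_pos[OF assms, of j] by simp
  have "((\<lambda>s. ln ((q $ Some i + s * v $ Some i) / (q $ None + s * v $ None))) has_real_derivative
      v $ Some i / (q $ Some i + s * v $ Some i) - v $ None / (q $ None + s * v $ None)) (at s)" for i
  proof -
    define A B where "A = q $ Some i + s * v $ Some i" and "B = q $ None + s * v $ None"
    have "A \<noteq> 0" "B \<noteq> 0" using pos[of "Some i"] pos[of None] by (simp_all add: A_def B_def)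
    then have eq: "1 / (A / B) * ((v $ Some i * B - A * v $ None) / (B * B)) = v $ Some i / A - v $ None / B"
      by (simp add: field_simps)
    have "((\<lambda>s. ln ((q $ Some i + s * v $ Some i) / (q $ None + s * v $ None))) has_real_derivative
        1 / (A / B) * ((v $ Some i * B - A * v $ None) / (B * B))) (at s)"
      unfolding A_def B_def using pos[of "Some i"] pos[of None]
      by (auto intro!: derivative_eq_intros)
    then show ?thesis unfolding eq by (simp add: A_def B_def)
  qed
  then show ?thesis
    unfolding expo_coord_def has_field_derivative_def
    by (subst has_derivative_componentwise_within)
      (auto simp: Basis_vec_def inner_axis mult_commute_abs)
qed

text \<open>
  In the exponential coordinate \<open>\<phi>\<close> is \<open>f - \<psi>\<close>, the gradient of \<open>f\<close> is the portfolio and the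
  gradient of \<open>\<psi>\<close> is the market itself; along a direction tangent to the simplex the market term
  and the last entry of the velocity cancel.
\<close>
lemma phi_line_derivative:
  assumes q: "q \<in> prob_simplex" and v: "(\<Sum>j\<in>UNIV. v $ j) = 0"
  shows "((\<lambda>s. \<phi> (q + s *\<^sub>R v)) has_real_derivative (\<Sum>j\<in>UNIV. \<pi> q $ j * (v $ j / q $ j))) (at 0)"
proof -
  define d where "d = (\<chi> i. v $ Some i / q $ Some i - v $ None / q $ None)"
  define x where "x = expo_coord q"
  have pos: "0 < q $ j" for j by (rule prob_simplex_pos[OF q])
  have x: "expo_point x = q" by (simp add: x_def expo_point_expo_coord[OF q])
  have "((\<lambda>s. expo_coord (q + s *\<^sub>R v)) has_derivative (\<lambda>r. r *\<^sub>R d)) (at 0)"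
    using expo_coord_line_has_derivative[of q 0 v] q by (simp add: d_def)
  moreover have "((\<lambda>y. f y - \<psi> y) has_derivative (\<lambda>u. (\<Sum>i\<in>UNIV. u $ i * partial i f x)
      - (\<Sum>i\<in>UNIV. u $ i * expo_point x $ Some i))) (at (expo_coord (q + 0 *\<^sub>R v)))"
    using has_derivative_diff[OF smooth_on_has_derivative[OF smooth_f, of x] psi_has_derivative[of x]]
    by (simp add: x_def)
  ultimately have "((\<lambda>s. f (expo_coord (q + s *\<^sub>R v)) - \<psi> (expo_coord (q + s *\<^sub>R v))) has_derivative
      (\<lambda>r. (\<Sum>i\<in>UNIV. (r *\<^sub>R d) $ i * partial i f x) - (\<Sum>i\<in>UNIV. (r *\<^sub>R d) $ i * expo_point x $ Some i))) (at 0)"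
    by (rule has_derivative_compose)
  also have "(\<lambda>r. (\<Sum>i\<in>UNIV. (r *\<^sub>R d) $ i * partial i f x) - (\<Sum>i\<in>UNIV. (r *\<^sub>R d) $ i * expo_point x $ Some i))
      = (*) (\<Sum>i\<in>UNIV. d $ i * \<pi> q $ Some i - d $ i * q $ Some i)"
    by (auto simp: partial_f x sum_distrib_left sum_distrib_right sum_subtractf algebra_simps)
  also have "(\<Sum>i\<in>UNIV. d $ i * \<pi> q $ Some i - d $ i * q $ Some i) = (\<Sum>j\<in>UNIV. \<pi> q $ j * (v $ j / q $ j))"
  proof -
    have "(\<Sum>i\<in>UNIV. d $ i * \<pi> q $ Some i) = (\<Sum>i\<in>UNIV. \<pi> q $ Some i * (v $ Some i / q $ Some i))
        - v $ None / q $ None * (\<Sum>i\<in>UNIV. \<pi> q $ Some i)"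
      by (simp add: d_def sum_subtractf sum_distrib_left algebra_simps)
    moreover have "(\<Sum>i\<in>UNIV. \<pi> q $ Some i) = 1 - \<pi> q $ None"
      using prob_simplex_sum[OF interior[OF q]] by (simp add: sum_UNIV_option)
    moreover have "(\<Sum>i\<in>UNIV. d $ i * q $ Some i) = (\<Sum>i\<in>UNIV. v $ Some i)
        - v $ None / q $ None * (\<Sum>i\<in>UNIV. q $ Some i)"
      unfolding sum_distrib_left sum_subtractf[symmetric] d_def
      using pos[of "Some _"] by (intro sum.cong) (simp_all add: left_diff_distrib less_imp_neq[THEN not_sym])
    moreover have "(\<Sum>i\<in>UNIV. q $ Some i) = 1 - q $ None"
      using prob_simplex_sum[OF q] by (simp add: sum_UNIV_option)
    moreover have "(\<Sum>i\<in>UNIV. v $ Some i) = - v $ None"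
      using v by (simp add: sum_UNIV_option)
    ultimately show ?thesis
      using pos[of None] by (simp add: sum_subtractf sum_UNIV_option field_simps)
  qed
  finally have "((\<lambda>s. f (expo_coord (q + s *\<^sub>R v)) - \<psi> (expo_coord (q + s *\<^sub>R v))) has_real_derivative
      (\<Sum>j\<in>UNIV. \<pi> q $ j * (v $ j / q $ j))) (at 0)"
    by (simp add: has_field_derivative_def)
  moreover have "\<forall>\<^sub>F s in nhds 0. \<phi> (q + s *\<^sub>R v) = f (expo_coord (q + s *\<^sub>R v)) - \<psi> (expo_coord (q + s *\<^sub>R v))"
    using simplex_line[OF q v] by eventually_elim (rule potential_expo_coord)
  ultimately show ?thesis
    by (subst DERIV_cong_ev[OF refl _ refl]) auto
qed

text \<open>
  The L-divergence is the gap in the duality inequality \<open>f x + f\<^sup>* (dual y) \<le> cost x (dual y)\<close>, where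
  \<open>f\<^sup>*\<close> is the \<open>c\<close>-transform of \<open>f\<close>.
\<close>
lemma L_div_expo:
  "L_div \<phi> (expo_point x) (expo_point y) = (cost x (dual y) - f x) - (cost y (dual y) - f y)"
proof -
  define p where "p = expo_point y"
  have p: "p \<in> prob_simplex" by (simp add: p_def)
  have "(\<Sum>j\<in>UNIV. (expo_point x - p) $ j) = 0"
    using prob_simplex_sum[OF p] prob_simplex_sum[OF expo_point_in_simplex, of x] by (simp add: sum_subtractf)
  from DERIV_imp_deriv[OF phi_line_derivative[OF p this]]
  have "dir_deriv \<phi> p (expo_point x - p) = (\<Sum>j\<in>UNIV. \<pi> p $ j * ((expo_point x - p) $ j / p $ j))"
    by (simp add: dir_deriv_def)
  also have "\<dots> = (\<Sum>j\<in>UNIV. \<pi> p $ j * (expo_point x $ j / p $ j)) - (\<Sum>j\<in>UNIV. \<pi> p $ j)"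
    unfolding sum_subtractf[symmetric] using prob_simplex_pos[OF p]
    by (intro sum.cong) (auto simp: diff_divide_distrib right_diff_distrib less_imp_neq[THEN not_sym])
  also have "(\<Sum>j\<in>UNIV. \<pi> p $ j) = 1" by (rule prob_simplex_sum[OF interior[OF p]])
  also have "(\<Sum>j\<in>UNIV. \<pi> p $ j * (expo_point x $ j / p $ j))
      = exp (cost x (dual y) - \<psi> x - (cost y (dual y) - \<psi> y))"
    using portfolio_value_eq[OF interior[OF p], of x y] by (simp add: p_def dual_def)
  finally have "1 + dir_deriv \<phi> p (expo_point x - p)
      = exp (cost x (dual y) - \<psi> x - (cost y (dual y) - \<psi> y))" by simp
  then show ?thesis unfolding L_div_def p_def by (simp add: potential_def)
qed

end

locale strictly_generated_portfolio = generated_portfolio \<phi> \<pi>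
  for \<phi> :: "real ^ 'm::finite option \<Rightarrow> real" and \<pi> +
  assumes hess: "hessian_neg_def (\<lambda>p. exp (\<phi> p))"
begin

text \<open>
  The form in which strict negativity of the Hessian is applied: \<open>exp \<circ> \<phi>\<close> has no vanishing second
  derivative along a line.
\<close>
lemma no_flat_direction:
  assumes p: "p \<in> prob_simplex" and v: "v \<noteq> 0" "(\<Sum>i\<in>UNIV. v $ i) = 0"
    and u: "\<forall>\<^sub>F s in nhds 0. ((\<lambda>r. exp (\<phi> (p + r *\<^sub>R v))) has_real_derivative u s) (at s)"
    and u': "(u has_real_derivative 0) (at 0)"
  shows False
proof -
  have "dir_deriv (\<lambda>q. exp (\<phi> q)) (p + s *\<^sub>R v) v = u s"
    if "((\<lambda>r. exp (\<phi> (p + r *\<^sub>R v))) has_real_derivative u s) (at s)" for s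
  proof -
    have "((\<lambda>r. exp (\<phi> (p + (r + s) *\<^sub>R v))) has_real_derivative u s) (at 0)"
      using that DERIV_shift[of "\<lambda>r. exp (\<phi> (p + r *\<^sub>R v))" "u s" 0 s] by simp
    moreover have "(\<lambda>r. exp (\<phi> (p + s *\<^sub>R v + r *\<^sub>R v))) = (\<lambda>r. exp (\<phi> (p + (r + s) *\<^sub>R v)))"
      by (simp add: algebra_simps)
    ultimately show ?thesis by (simp only: dir_deriv_def DERIV_imp_deriv)
  qed
  then have "\<forall>\<^sub>F s in nhds 0. dir_deriv (\<lambda>q. exp (\<phi> q)) (p + s *\<^sub>R v) v = u s"
    using u by (auto elim: eventually_mono)
  then have "((\<lambda>s. dir_deriv (\<lambda>q. exp (\<phi> q)) (p + s *\<^sub>R v) v) has_real_derivative 0) (at 0)"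
    using u' by (subst DERIV_cong_ev[OF refl _ refl])
  then have "dir_deriv (\<lambda>q. dir_deriv (\<lambda>q. exp (\<phi> q)) q v) p v = 0"
    unfolding dir_deriv_def[of "\<lambda>q. dir_deriv _ q v"] by (rule DERIV_imp_deriv)
  moreover have "dir_deriv (\<lambda>q. dir_deriv (\<lambda>q. exp (\<phi> q)) q v) p v < 0"
    using hess p v unfolding hessian_neg_def_def by blast
  ultimately show False by simp
qed

text \<open>
  If two points had the same dual coordinate, the same affine function would support \<open>exp \<circ> \<phi>\<close> at
  both, up to scale; by concavity \<open>exp \<circ> \<phi>\<close> would be affine on the segment between them.
\<close>
lemma inj_W: "inj W"
proof (rule injI, rule ccontr)
  fix x y assume W: "W x = W y" and xy: "x \<noteq> y"
  define p where "p = expo_point x"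
  define q where "q = expo_point y"
  define l where "l r = r $ None + (\<Sum>a\<in>UNIV. W x $ a * r $ Some a)" for r :: "real ^ 'm option"
  have p: "p \<in> prob_simplex" and q: "q \<in> prob_simplex" by (simp_all add: p_def q_def)
  have l_pos: "0 < l r" if "r \<in> prob_simplex" for r
    unfolding l_def using prob_simplex_pos[OF that]
    by (intro add_pos_nonneg sum_nonneg mult_nonneg_nonneg) (auto intro: less_imp_le W_pos)
  have lin: "l (u *\<^sub>R r + v *\<^sub>R r') = u * l r + v * l r'" for u v r r'
    by (simp add: l_def sum_distrib_left sum.distrib algebra_simps)
  have supp: "exp (\<phi> r) \<le> exp (\<phi> z) * (l r / l z)"
    if z: "z \<in> prob_simplex" "W (expo_coord z) = W x" and r: "r \<in> prob_simplex" for r z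
  proof -
    have "exp (\<phi> r - \<phi> z) \<le> (\<Sum>j\<in>UNIV. \<pi> z $ j * (r $ j / z $ j))"
      using generated z r unfolding generates_def by blast
    also have "\<dots> = (\<Sum>j\<in>UNIV. \<pi> z $ j / z $ j * r $ j)" by (simp add: mult.commute)
    also have "\<dots> = l r / l z"
      unfolding sum_UNIV_option portfolio_ratio[OF z(1)] z(2) l_def
      by (simp add: add_divide_distrib sum_divide_distrib)
    finally show ?thesis by (simp add: exp_diff pos_divide_le_eq mult.commute)
  qed
  define C where "C = exp (\<phi> p) / l p"
  have Wp: "W (expo_coord p) = W x" and Wq: "W (expo_coord q) = W x"
    using W by (simp_all add: p_def q_def)
  have C: "exp (\<phi> p) = C * l p" "exp (\<phi> q) = C * l q"
  proof -
    show "exp (\<phi> p) = C * l p" using l_pos[OF p] by (simp add: C_def)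
    have "exp (\<phi> q) \<le> C * l q" using supp[OF p Wp q] by (simp add: C_def)
    moreover have "C * l q \<le> exp (\<phi> q)"
      using supp[OF q Wq p] l_pos[OF p] l_pos[OF q] by (simp add: C_def field_simps)
    ultimately show "exp (\<phi> q) = C * l q" by simp
  qed
  define m where "m = (1/2) *\<^sub>R p + (1/2) *\<^sub>R q"
  define v where "v = q - p"
  have m: "m \<in> prob_simplex" unfolding m_def by (rule convexD[OF convex_prob_simplex p q]) auto
  have v: "v \<noteq> 0" "(\<Sum>i\<in>UNIV. v $ i) = 0"
    using xy prob_simplex_sum[OF p] prob_simplex_sum[OF q]
    by (auto simp: v_def p_def q_def expo_point_inject sum_subtractf)
  have affine: "exp (\<phi> (m + s *\<^sub>R v)) = C * l m + s * (C * l v)" if s: "\<bar>s\<bar> < 1/2" for s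
  proof -
    have eq: "m + s *\<^sub>R v = (1/2 - s) *\<^sub>R p + (1/2 + s) *\<^sub>R q"
      by (simp add: m_def v_def algebra_simps)
    have in_S: "m + s *\<^sub>R v \<in> prob_simplex"
      unfolding eq using s by (intro convexD[OF convex_prob_simplex p q]) auto
    have "exp_concave \<phi>" using generated by (simp add: generates_def)
    then have "(1/2 - s) * exp (\<phi> p) + (1/2 + s) * exp (\<phi> q) \<le> exp (\<phi> (m + s *\<^sub>R v))"
      unfolding eq exp_concave_def concave_on_iff using p q s by auto
    moreover have "(1/2 - s) * exp (\<phi> p) + (1/2 + s) * exp (\<phi> q) = C * l (m + s *\<^sub>R v)"
      unfolding eq lin C by (simp add: algebra_simps)
    moreover have "exp (\<phi> (m + s *\<^sub>R v)) \<le> C * l (m + s *\<^sub>R v)"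
      using supp[OF p Wp in_S] by (simp add: C_def)
    moreover have "l (m + s *\<^sub>R v) = l m + s * l v" using lin[of 1 m s v] by simp
    ultimately show ?thesis by (simp add: algebra_simps)
  qed
  have "((\<lambda>r. exp (\<phi> (m + r *\<^sub>R v))) has_real_derivative C * l v) (at s)" if "\<bar>s\<bar> < 1/2" for s
  proof -
    have "\<forall>\<^sub>F r in nhds s. \<bar>r\<bar> < 1/2"
      using that by (intro order_tendstoD(2)[of abs "\<bar>s\<bar>"]) (auto intro!: tendsto_intros filterlim_ident)
    then have "\<forall>\<^sub>F r in nhds s. exp (\<phi> (m + r *\<^sub>R v)) = C * l m + r * (C * l v)"
      by eventually_elim (rule affine)
    moreover have "((\<lambda>r. C * l m + r * (C * l v)) has_real_derivative C * l v) (at s)"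
      by (auto intro!: derivative_eq_intros)
    ultimately show ?thesis by (subst DERIV_cong_ev[OF refl _ refl])
  qed
  moreover have "\<forall>\<^sub>F s in nhds 0. \<bar>s :: real\<bar> < 1/2"
    by (intro order_tendstoD(2)[of abs 0]) (auto intro!: tendsto_eq_intros filterlim_ident)
  ultimately show False
    by (intro no_flat_direction[OF m v, of "\<lambda>s. C * l v"]) (auto elim: eventually_mono)
qed

end

section \<open>The geometry induced by the L-divergence\<close>

lemma exp_line_derivative:
  "((\<lambda>r. exp ((x + r *\<^sub>R axis k 1) $ a)) has_real_derivative (if a = k then exp (x $ a) else 0)) (at 0)"
  by (auto intro!: derivative_eq_intros simp: axis_def)

text \<open>
  The linear form \<open>E x\<close> is what the cost retains of \<open>x\<close> after exponentiation:
  \<open>exp (cost x \<eta>) = 1 + E x v\<close> for \<open>v\<^sub>a = exp (- \<eta>\<^sub>a)\<close>.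
\<close>
definition E :: "real ^ 'm::finite \<Rightarrow> real ^ 'm \<Rightarrow> real" where
  "E x v = (\<Sum>a\<in>UNIV. v $ a * exp (x $ a))"

lemma E_linear: "linear (E x)"
  by (auto intro!: linearI simp: E_def sum.distrib distrib_right sum_distrib_left mult.assoc)

lemma E_line_derivative:
  "((\<lambda>r. E (x + r *\<^sub>R axis k 1) v) has_real_derivative v $ k * exp (x $ k)) (at 0)"
proof -
  have "((\<lambda>r. E (x + r *\<^sub>R axis k 1) v) has_real_derivative
      (\<Sum>a\<in>UNIV. v $ a * (if a = k then exp (x $ a) else 0))) (at 0)"
    unfolding E_def by (intro DERIV_sum DERIV_cmult exp_line_derivative)
  then show ?thesis by (simp add: if_distrib cong: if_cong)
qed

context generated_portfolio
begin

text \<open>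
  The exponential of \<open>cost x (dual y)\<close>.
\<close>
definition s :: "real ^ 'm \<Rightarrow> real ^ 'm \<Rightarrow> real" where
  "s x y = 1 + E x (W y)"

text \<open>
  The negative of the \<open>c\<close>-transform of \<open>f\<close> at \<open>dual y\<close>, that is, the part of the L-divergence that
  depends on its second argument alone. It drops out of the metric and of the dual connection, which
  contain a derivative in the first argument.
\<close>
definition \<Phi> :: "real ^ 'm \<Rightarrow> real" where
  "\<Phi> y = f y - ln (s y y)"

abbreviation D :: "real ^ 'm \<Rightarrow> real ^ 'm \<Rightarrow> real" where
  "D x y \<equiv> L_div \<phi> (expo_point x) (expo_point y)"

lemma s_pos: "0 < s x y"
  unfolding s_def E_def using W_pos by (intro add_pos_nonneg sum_nonneg) (auto intro: less_imp_le)

lemma D_eq: "D x y = ln (s x y) - f x + \<Phi> y"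
proof -
  have "cost x (dual y) = ln (s x y)" for x
    by (simp add: cost_def \<psi>_def s_def E_def W_def exp_diff exp_minus divide_inverse mult.commute)
  then show ?thesis by (simp add: L_div_expo \<Phi>_def)
qed

lemma Ck_on_s: "Ck_on k UNIV (\<lambda>y. s y y)"
  unfolding s_def E_def
  by (intro Ck_on_add Ck_on_const Ck_on_sum Ck_on_mult Ck_on_exp Ck_on_nth smooth_on_D[OF smooth_W])

lemma smooth_Phi: "smooth_on UNIV \<Phi>"
  unfolding smooth_on_def \<Phi>_def[abs_def]
  using s_pos by (intro allI Ck_on_diff Ck_on_ln Ck_on_s smooth_on_D[OF smooth_f])

lemma E_W_line_derivative: "((\<lambda>r. E x (W (y + r *\<^sub>R axis j 1))) has_real_derivative E x (dW j y)) (at 0)"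
proof -
  have "((\<lambda>r. W (y + r *\<^sub>R axis j 1) $ a) has_real_derivative dW j y $ a) (at 0)" for a
    using line_derivative[OF W_has_derivative[of a y], of "axis j 1"]
    by (simp add: axis_def if_distrib if_distribR cong: if_cong)
  then show ?thesis unfolding E_def by (intro DERIV_sum DERIV_cmult_right)
qed

lemma s_line_derivative: "((\<lambda>r. s x (y + r *\<^sub>R axis j 1)) has_real_derivative E x (dW j y)) (at 0)"
  unfolding s_def using DERIV_add[OF DERIV_const E_W_line_derivative] by simp

lemma E_dW_line_derivative:
  "((\<lambda>r. E x (dW j (y + r *\<^sub>R axis i 1))) has_real_derivative E x (ddW i j y)) (at 0)"
proof -
  have "((\<lambda>r. dW j (y + r *\<^sub>R axis i 1) $ a) has_real_derivative ddW i j y $ a) (at 0)" for a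
    using line_derivative[OF dW_has_derivative[of j a y], of "axis i 1"]
    by (simp add: axis_def if_distrib if_distribR cong: if_cong)
  then show ?thesis unfolding E_def by (intro DERIV_sum DERIV_cmult_right)
qed

lemma smooth_line_derivative:
  assumes "smooth_on UNIV h"
  shows "((\<lambda>r. h (x + r *\<^sub>R axis i 1)) has_real_derivative partial i h x) (at 0)"
  using smooth_on_partial_line[OF assms, of x i 0] by simp

lemma partial_D: "partial j (D x) y = E x (dW j y) / s x y + partial j \<Phi> y"
proof (rule partial_eq_line)
  have "((\<lambda>r. ln (s x (y + r *\<^sub>R axis j 1)) - f x + \<Phi> (y + r *\<^sub>R axis j 1)) has_real_derivative
      E x (dW j y) / s x y + partial j \<Phi> y) (at 0)"
    using DERIV_add[OF DERIV_diff[OF DERIV_chain2[OF DERIV_ln_divide s_line_derivative] DERIV_const]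
        smooth_line_derivative[OF smooth_Phi], of x y j "f x" y j] s_pos[of x y] by simp
  then show "((\<lambda>r. D x (y + r *\<^sub>R axis j 1)) has_real_derivative
      E x (dW j y) / s x y + partial j \<Phi> y) (at 0)"
    by (simp add: D_eq)
qed

lemma partial_partial_D:
  "partial i (\<lambda>y. partial j (D x) y) y =
    E x (ddW i j y) / s x y - E x (dW i y) / s x y * (E x (dW j y) / s x y) + partial i (partial j \<Phi>) y"
proof (rule partial_eq_line)
  have "((\<lambda>r. E x (dW j (y + r *\<^sub>R axis i 1)) / s x (y + r *\<^sub>R axis i 1) + partial j \<Phi> (y + r *\<^sub>R axis i 1))
      has_real_derivative (E x (ddW i j y) * s x y - E x (dW j y) * E x (dW i y)) / (s x y * s x y)
        + partial i (partial j \<Phi>) y) (at 0)"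
    using DERIV_add[OF DERIV_divide[OF E_dW_line_derivative[of x j y i] s_line_derivative[of x y i]]
        smooth_line_derivative[OF smooth_on_partial[OF smooth_Phi, of j], of y i]] s_pos[of x y] by simp
  moreover have "(E x (ddW i j y) * s x y - E x (dW j y) * E x (dW i y)) / (s x y * s x y)
      = E x (ddW i j y) / s x y - E x (dW i y) / s x y * (E x (dW j y) / s x y)"
    using s_pos[of x y] by (simp add: field_simps)
  ultimately show "((\<lambda>r. partial j (D x) (y + r *\<^sub>R axis i 1)) has_real_derivative
      E x (ddW i j y) / s x y - E x (dW i y) / s x y * (E x (dW j y) / s x y) + partial i (partial j \<Phi>) y) (at 0)"
    by (simp add: partial_D)
qed

text \<open>
  The gradient in \<open>x\<close>, on the diagonal, of \<open>E x v / s x y\<close>. Every quotient of this form that occurs in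
  the derivatives of the L-divergence in its second argument is linear in \<open>v\<close>, so the metric and
  the connection are built from values of one linear map.
\<close>
definition M :: "real ^ 'm \<Rightarrow> real ^ 'm \<Rightarrow> real ^ 'm" where
  "M x v = (\<chi> k. exp (x $ k) * (v $ k / s x x - E x v * W x $ k / (s x x * s x x)))"

lemma M_linear: "linear (M x)"
  by (rule linearI)
    (simp_all add: M_def vec_eq_iff linear_add[OF E_linear] linear_cmul[OF E_linear]
      add_divide_distrib algebra_simps)

text \<open>
  With the weights \<open>h\<^sub>a = W\<^sub>a exp x\<^sub>a / s\<close>, which are positive and of total mass less than 1, the
  matrix of \<open>M x\<close> is \<open>diag h - h h\<^sup>T\<close> up to the scaling of the argument by \<open>W x\<close>. Summing the
  components of \<open>M x v = 0\<close> gives \<open>E x v = 0\<close>.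
\<close>
lemma M_eq_0_iff: "M x v = 0 \<longleftrightarrow> v = 0"
proof
  assume "M x v = 0"
  then have v: "v $ k = E x v / s x x * W x $ k" for k
    using s_pos[of x x] by (simp add: M_def vec_eq_iff field_simps)
  have "E x v = E x v / s x x * E x (W x)"
    by (subst E_def, subst v) (simp add: E_def sum_distrib_left mult.assoc)
  then have "E x v * s x x = E x v * (s x x - 1)"
    using s_pos[of x x] by (simp add: s_def field_simps)
  then have "E x v = 0" by (simp add: algebra_simps)
  then show "v = 0" using v by (simp add: vec_eq_iff)
qed (simp add: linear_0[OF M_linear])

lemma quotient_line_derivative:
  "((\<lambda>r. E (x + r *\<^sub>R axis k 1) v / s (x + r *\<^sub>R axis k 1) x) has_real_derivative M x v $ k) (at 0)"
proof -
  have "((\<lambda>r. E (x + r *\<^sub>R axis k 1) v / s (x + r *\<^sub>R axis k 1) x) has_real_derivative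
      (v $ k * exp (x $ k) * s x x - E x v * (W x $ k * exp (x $ k))) / (s x x * s x x)) (at 0)"
    unfolding s_def
    by (rule derivative_eq_intros E_line_derivative refl)+
      (use s_pos[of x x] in \<open>simp_all add: s_def\<close>)
  moreover have "(v $ k * exp (x $ k) * s x x - E x v * (W x $ k * exp (x $ k))) / (s x x * s x x) = M x v $ k"
    using s_pos[of x x] by (simp add: M_def field_simps)
  ultimately show ?thesis by simp
qed

lemma div_metric_D: "div_metric D x $ k $ j = - M x (dW j x) $ k"
proof -
  have "((\<lambda>r. partial j (D (x + r *\<^sub>R axis k 1)) x) has_real_derivative M x (dW j x) $ k) (at 0)"
    unfolding partial_D
    using DERIV_add[OF quotient_line_derivative[of x k "dW j x"] DERIV_const[of "partial j \<Phi> x"]] by simp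
  then have "partial k (\<lambda>y. partial j (D y) x) x = M x (dW j x) $ k" by (rule partial_eq_line)
  then show ?thesis by (simp add: div_metric_def)
qed

lemma dual_christoffel_lower_D:
  "dual_christoffel_lower D x i j k =
    - (M x (ddW i j x) $ k - E x (dW i x) / s x x * M x (dW j x) $ k - E x (dW j x) / s x x * M x (dW i x) $ k)"
proof -
  have "((\<lambda>r. partial i (\<lambda>y. partial j (D (x + r *\<^sub>R axis k 1)) y) x) has_real_derivative
      M x (ddW i j x) $ k - (M x (dW i x) $ k * (E x (dW j x) / s x x) + M x (dW j x) $ k * (E x (dW i x) / s x x)) + 0) (at 0)"
    unfolding partial_partial_D
    using DERIV_mult[OF quotient_line_derivative[of x k "dW i x"] quotient_line_derivative[of x k "dW j x"]]
    by (intro DERIV_add DERIV_diff DERIV_const quotient_line_derivative) simp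
  then have "partial k (\<lambda>z. partial i (\<lambda>y. partial j (D z) y) x) x =
      M x (ddW i j x) $ k - (M x (dW i x) $ k * (E x (dW j x) / s x x) + M x (dW j x) $ k * (E x (dW i x) / s x x)) + 0"
    by (rule partial_eq_line)
  then show ?thesis by (simp add: dual_christoffel_lower_def algebra_simps)
qed

lemma partial_f_W: "partial k f y = W y $ k * exp (y $ k) / s y y"
proof -
  have p: "expo_point y $ Some a = exp (y $ a) * expo_point y $ None" for a
    by (simp add: expo_point_Some expo_point_None exp_diff exp_minus divide_inverse)
  have pos: "0 < expo_point y $ None" by (simp add: expo_point_None)
  have "expo_point y $ None + (\<Sum>a\<in>UNIV. W y $ a * expo_point y $ Some a) = expo_point y $ None * s y y"
    by (simp add: p s_def E_def sum_distrib_left algebra_simps)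
  then show ?thesis
    using portfolio_ratio(2)[OF expo_point_in_simplex, of y k] pos s_pos[of y y]
    by (simp add: partial_f p field_simps)
qed

text \<open>
  The symmetry of the metric. The first-order condition \<open>partial_f_W\<close> holds identically in \<open>y\<close>;
  differentiating it writes \<open>M x (dW j x)\<close> as the difference of the Hessian of \<open>f\<close> and the Hessian
  of \<open>cost\<close> in its first argument.
\<close>
lemma M_dW_symmetric: "M x (dW j x) $ k = M x (dW k x) $ j"
proof -
  define H where "H j k = (if k = j then W x $ k * exp (x $ k) / s x x else 0)
      - (W x $ k * exp (x $ k)) * (W x $ j * exp (x $ j)) / (s x x * s x x)" for j k
  have "partial j (partial k f) x = M x (dW j x) $ k + H j k" for j k
  proof (rule partial_eq_line)
    have Wl: "((\<lambda>r. W (x + r *\<^sub>R axis j 1) $ a) has_real_derivative dW j x $ a) (at 0)" for a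
      using line_derivative[OF W_has_derivative[of a x], of "axis j 1"]
      by (simp add: axis_def if_distrib if_distribR cong: if_cong)
    have sl: "((\<lambda>r. s (x + r *\<^sub>R axis j 1) (x + r *\<^sub>R axis j 1)) has_real_derivative
        E x (dW j x) + W x $ j * exp (x $ j)) (at 0)"
    proof -
      have "((\<lambda>r. s (x + r *\<^sub>R axis j 1) (x + r *\<^sub>R axis j 1)) has_real_derivative
        0 + (\<Sum>a\<in>UNIV. dW j x $ a * exp ((x + 0 *\<^sub>R axis j 1) $ a)
          + (if a = j then exp (x $ a) else 0) * W (x + 0 *\<^sub>R axis j 1) $ a)) (at 0)"
        unfolding s_def E_def by (intro DERIV_add DERIV_const DERIV_sum DERIV_mult Wl exp_line_derivative)
      moreover have "(\<Sum>a\<in>UNIV. (if a = j then exp (x $ a) else 0) * W x $ a) = W x $ j * exp (x $ j)"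
        by (simp add: if_distrib[where f = "\<lambda>z. z * _"] cong: if_cong)
      ultimately show ?thesis
        unfolding sum.distrib by (simp add: E_def)
    qed
    have "((\<lambda>r. W (x + r *\<^sub>R axis j 1) $ k * exp ((x + r *\<^sub>R axis j 1) $ k) /
        s (x + r *\<^sub>R axis j 1) (x + r *\<^sub>R axis j 1)) has_real_derivative
        ((dW j x $ k * exp (x $ k) + (if k = j then exp (x $ k) else 0) * W x $ k) * s x x
          - W x $ k * exp (x $ k) * (E x (dW j x) + W x $ j * exp (x $ j))) / (s x x * s x x)) (at 0)"
      using DERIV_divide[OF DERIV_mult[OF Wl[of k] exp_line_derivative[of x j k]] sl] s_pos[of x x] by simp
    moreover have "((dW j x $ k * exp (x $ k) + (if k = j then exp (x $ k) else 0) * W x $ k) * s x x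
          - W x $ k * exp (x $ k) * (E x (dW j x) + W x $ j * exp (x $ j))) / (s x x * s x x)
        = M x (dW j x) $ k + H j k"
      using s_pos[of x x] by (cases "k = j") (simp_all add: M_def H_def field_simps)
    ultimately show "((\<lambda>r. partial k f (x + r *\<^sub>R axis j 1)) has_real_derivative M x (dW j x) $ k + H j k) (at 0)"
      by (simp add: partial_f_W)
  qed
  moreover have "H j k = H k j" by (auto simp: H_def mult.commute)
  ultimately show ?thesis
    using partial_commute[OF smooth_f, of j k x] by (metis add_right_cancel)
qed

definition jacobian :: "real ^ 'm \<Rightarrow> real ^ 'm ^ 'm" where
  "jacobian x = (\<chi> a j. dW j x $ a)"

definition d2W :: "real ^ 'm \<Rightarrow> real ^ 'm \<Rightarrow> real ^ 'm" where
  "d2W x u = (\<Sum>i\<in>UNIV. \<Sum>j\<in>UNIV. (u $ i * u $ j) *\<^sub>R ddW i j x)"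

lemma jacobian_mult: "jacobian x *v u = (\<Sum>j\<in>UNIV. u $ j *\<^sub>R dW j x)"
  by (simp add: jacobian_def matrix_vector_mult_def vec_eq_iff mult.commute)

lemma div_metric_mult: "div_metric D x *v u = - M x (jacobian x *v u)"
  by (simp add: vec_eq_iff matrix_vector_mult_def[of "div_metric D x"] div_metric_D jacobian_mult
      linear_sum[OF M_linear] linear_cmul[OF M_linear] sum_negf mult.commute)

lemma transpose_div_metric: "transpose (div_metric D x) = div_metric D x"
  by (simp add: vec_eq_iff transpose_def div_metric_D M_dW_symmetric)

end

lemma matrix_inv_works:
  assumes "invertible A"
  shows "A ** matrix_inv A = mat 1" and "matrix_inv A ** A = mat 1"
  using someI_ex[OF assms[unfolded invertible_def]] by (simp_all add: matrix_inv_def)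

context strictly_generated_portfolio
begin

text \<open>
  Follow the line in the simplex whose image in the exponential coordinate starts in the direction
  \<open>u\<close>. There the logarithmic derivative of \<open>exp \<circ> \<phi>\<close> is \<open>l / \<omega>\<close>, where \<open>l\<close> and \<open>\<omega>\<close> are the values
  of the linear form with the coefficients \<open>(W, 1)\<close> at the direction and at the point. If \<open>W\<close> is
  stationary to first order, then \<open>l' = 0\<close> and \<open>\<omega>' = l\<close>, and the second derivative of \<open>exp \<circ> \<phi>\<close>
  along the line vanishes.
\<close>
lemma dW_injective:
  assumes u: "jacobian x *v u = 0"
  shows "u = 0"
proof (rule ccontr)
  assume "u \<noteq> 0"
  define p where "p = expo_point x"
  define m where "m = (\<Sum>i\<in>UNIV. p $ Some i * u $ i)"
  define v where "v = (\<chi> j. case j of None \<Rightarrow> - p $ None * m | Some i \<Rightarrow> p $ Some i * (u $ i - m))"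
  define \<xi> where "\<xi> r = expo_coord (p + r *\<^sub>R v)" for r
  define l where "l r = v $ None + (\<Sum>a\<in>UNIV. W (\<xi> r) $ a * v $ Some a)" for r
  define \<omega> where "\<omega> r = (p + r *\<^sub>R v) $ None + (\<Sum>a\<in>UNIV. W (\<xi> r) $ a * (p + r *\<^sub>R v) $ Some a)" for r
  have p: "p \<in> prob_simplex" by (simp add: p_def)
  have pos: "0 < p $ j" for j by (rule prob_simplex_pos[OF p])
  have \<xi>0: "\<xi> 0 = x" by (simp add: \<xi>_def p_def)
  have sum_v: "(\<Sum>i\<in>UNIV. v $ i) = 0"
  proof -
    have m: "(\<Sum>i\<in>UNIV. u $ i * p $ Some i) = m" by (simp add: m_def mult.commute)
    have "(\<Sum>i\<in>UNIV. v $ Some i) = m - m * (\<Sum>i\<in>UNIV. p $ Some i)"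
      by (simp add: v_def right_diff_distrib sum_subtractf sum_distrib_left mult.commute m)
    then have "(\<Sum>i\<in>UNIV. v $ i) = m - m * (\<Sum>j\<in>UNIV. p $ j)"
      by (simp add: sum_UNIV_option v_def[THEN arg_cong[of _ _ "\<lambda>v. v $ None"]] algebra_simps)
    then show ?thesis by (simp add: prob_simplex_sum[OF p])
  qed
  have dir: "(\<chi> i. v $ Some i / p $ Some i - v $ None / p $ None) = u"
    using pos by (simp add: v_def vec_eq_iff less_imp_neq[THEN not_sym])
  have "v \<noteq> 0" using dir \<open>u \<noteq> 0\<close> by (auto simp: zero_vec_def)
  have \<xi>: "(\<xi> has_derivative (\<lambda>r. r *\<^sub>R u)) (at 0)"
    using expo_coord_line_has_derivative[of p 0 v] p dir by (simp add: \<xi>_def[abs_def])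
  have W\<xi>: "((\<lambda>r. W (\<xi> r) $ a) has_real_derivative 0) (at 0)" for a
  proof -
    have "((\<lambda>r. W (\<xi> r) $ a) has_derivative (\<lambda>r. \<Sum>j\<in>UNIV. (r *\<^sub>R u) $ j * dW j (\<xi> 0) $ a)) (at 0)"
      by (rule has_derivative_compose[OF \<xi> W_has_derivative])
    moreover have "(\<Sum>j\<in>UNIV. (r *\<^sub>R u) $ j * dW j (\<xi> 0) $ a) = r * (jacobian x *v u) $ a" for r
      by (simp add: \<xi>0 jacobian_mult sum_distrib_left mult.assoc)
    ultimately show ?thesis by (simp add: u has_field_derivative_def lambda_zero)
  qed
  have l: "(l has_real_derivative 0) (at 0)"
    unfolding l_def[abs_def] by (auto intro!: derivative_eq_intros W\<xi>)
  have \<omega>: "(\<omega> has_real_derivative l 0) (at 0)"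
    unfolding \<omega>_def[abs_def] by (auto intro!: derivative_eq_intros W\<xi> simp: l_def mult.commute)
  have \<omega>0: "0 < \<omega> 0"
    unfolding \<omega>_def
    by (intro add_pos_nonneg sum_nonneg mult_nonneg_nonneg) (simp_all add: less_imp_le W_pos pos)
  define U where "U r = exp (\<phi> (p + r *\<^sub>R v))" for r
  have U: "(U has_real_derivative U r * (l r / \<omega> r)) (at r)" if "p + r *\<^sub>R v \<in> prob_simplex" for r
  proof -
    have "((\<lambda>r'. \<phi> (p + r *\<^sub>R v + r' *\<^sub>R v)) has_real_derivative
        (\<Sum>j\<in>UNIV. \<pi> (p + r *\<^sub>R v) $ j * (v $ j / (p + r *\<^sub>R v) $ j))) (at 0)"
      by (rule phi_line_derivative[OF that sum_v])
    also have "(\<Sum>j\<in>UNIV. \<pi> (p + r *\<^sub>R v) $ j * (v $ j / (p + r *\<^sub>R v) $ j))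
        = (\<Sum>j\<in>UNIV. \<pi> (p + r *\<^sub>R v) $ j / (p + r *\<^sub>R v) $ j * v $ j)"
      by simp
    also have "\<dots> = l r / \<omega> r"
      unfolding sum_UNIV_option portfolio_ratio[OF that] \<xi>_def[symmetric] \<omega>_def[symmetric]
      by (simp add: l_def add_divide_distrib sum_divide_distrib)
    also have "(\<lambda>r'. \<phi> (p + r *\<^sub>R v + r' *\<^sub>R v)) = (\<lambda>r'. \<phi> (p + (r' + r) *\<^sub>R v))"
      by (simp add: algebra_simps)
    finally have "((\<lambda>r'. \<phi> (p + r' *\<^sub>R v)) has_real_derivative l r / \<omega> r) (at r)"
      using DERIV_shift[of "\<lambda>r'. \<phi> (p + r' *\<^sub>R v)" "l r / \<omega> r" 0 r] by simp
    then show ?thesis unfolding U_def[abs_def] by (rule DERIV_fun_exp)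
  qed
  have flat: "((\<lambda>r. U r * (l r / \<omega> r)) has_real_derivative 0) (at 0)"
  proof -
    have "((\<lambda>r. U r * (l r / \<omega> r)) has_real_derivative
        U 0 * (l 0 / \<omega> 0) * (l 0 / \<omega> 0) + (0 * \<omega> 0 - l 0 * l 0) / (\<omega> 0 * \<omega> 0) * U 0) (at 0)"
      using \<omega>0 p by (intro DERIV_mult DERIV_divide U l \<omega>) auto
    then show ?thesis by simp
  qed
  have "\<forall>\<^sub>F r in nhds 0. (U has_real_derivative U r * (l r / \<omega> r)) (at r)"
    using simplex_line[OF p sum_v] by eventually_elim (rule U)
  from no_flat_direction[OF p \<open>v \<noteq> 0\<close> sum_v this[unfolded U_def[abs_def]] flat[unfolded U_def[abs_def]]]
  show False .
qed

lemma invertible_if_injective: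
  fixes A :: "real ^ 'k::finite ^ 'k"
  assumes "\<And>u. A *v u = 0 \<Longrightarrow> u = 0"
  shows "invertible A"
  using assms by (metis invertible_left_inverse matrix_left_invertible_ker)

lemma invertible_jacobian: "invertible (jacobian x)"
  by (rule invertible_if_injective[OF dW_injective])

lemma invertible_div_metric: "invertible (div_metric D x)"
  by (rule invertible_if_injective) (simp add: div_metric_mult M_eq_0_iff dW_injective)

text \<open>
  Lowering the index and dropping the injective map \<open>M x\<close> leaves an equation for the curve in the
  coordinate \<open>W\<close>: its acceleration is a multiple of its velocity.
\<close>
lemma geodesic_equation_iff:
  "(\<forall>k. a $ k + (\<Sum>i\<in>UNIV. \<Sum>j\<in>UNIV. dual_christoffel D x i j k * u $ i * u $ j) = 0)
    \<longleftrightarrow> jacobian x *v a + d2W x u = (2 * E x (jacobian x *v u) / s x x) *\<^sub>R (jacobian x *v u)"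
proof -
  define Y where "Y u = (\<Sum>j\<in>UNIV. u $ j *\<^sub>R dW j x)" for u
  define Q where "Q u = (\<Sum>i\<in>UNIV. \<Sum>j\<in>UNIV. (u $ i * u $ j) *\<^sub>R ddW i j x)" for u
  define g where "g = div_metric D x"
  define L where "L = (\<chi> k. \<Sum>i\<in>UNIV. \<Sum>j\<in>UNIV. dual_christoffel_lower D x i j k * (u $ i * u $ j))"
  have g: "invertible g" "transpose g = g"
    by (simp_all add: g_def invertible_div_metric transpose_div_metric)
  have gi: "matrix_inv g ** g = mat 1"
    using g(1) by (rule matrix_inv_works)
  have chr: "(\<Sum>i\<in>UNIV. \<Sum>j\<in>UNIV. dual_christoffel D x i j k * u $ i * u $ j)
      = (transpose (matrix_inv g) *v L) $ k" for k
  proof -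
    have "(\<Sum>i\<in>UNIV. \<Sum>j\<in>UNIV. dual_christoffel D x i j k * u $ i * u $ j)
        = (\<Sum>i\<in>UNIV. \<Sum>j\<in>UNIV. \<Sum>m\<in>UNIV. matrix_inv g $ m $ k * (dual_christoffel_lower D x i j m * (u $ i * u $ j)))"
      unfolding dual_christoffel_def g_def by (simp add: sum_distrib_left sum_distrib_right mult_ac)
    also have "\<dots> = (\<Sum>i\<in>UNIV. \<Sum>m\<in>UNIV. \<Sum>j\<in>UNIV. matrix_inv g $ m $ k * (dual_christoffel_lower D x i j m * (u $ i * u $ j)))"
      by (intro sum.cong refl sum.swap)
    also have "\<dots> = (\<Sum>m\<in>UNIV. \<Sum>i\<in>UNIV. \<Sum>j\<in>UNIV. matrix_inv g $ m $ k * (dual_christoffel_lower D x i j m * (u $ i * u $ j)))"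
      by (rule sum.swap)
    finally show ?thesis by (simp add: L_def matrix_vector_mult_def transpose_def sum_distrib_left)
  qed
  have L: "L = - M x (Q u - (2 * E x (Y u) / s x x) *\<^sub>R Y u)"
  proof -
    have cross: "(\<Sum>i\<in>UNIV. \<Sum>j\<in>UNIV. (E x (dW i x) / s x x * M x (dW j x) $ k) * (u $ i * u $ j))
        = E x (Y u) / s x x * M x (Y u) $ k" for k
    proof -
      have "E x (Y u) / s x x * M x (Y u) $ k
        = (\<Sum>i\<in>UNIV. u $ i * (E x (dW i x) / s x x)) * (\<Sum>j\<in>UNIV. u $ j * M x (dW j x) $ k)"
        by (simp add: Y_def linear_sum[OF M_linear] linear_cmul[OF M_linear] linear_sum[OF E_linear]
          linear_cmul[OF E_linear] sum_divide_distrib)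
      also have "\<dots> = (\<Sum>i\<in>UNIV. \<Sum>j\<in>UNIV. (E x (dW i x) / s x x * M x (dW j x) $ k) * (u $ i * u $ j))"
        unfolding sum_product by (intro sum.cong refl) (simp only: mult_ac)
      finally show ?thesis by (rule sym)
    qed
    have cross': "(\<Sum>i\<in>UNIV. \<Sum>j\<in>UNIV. (E x (dW j x) / s x x * M x (dW i x) $ k) * (u $ i * u $ j))
        = E x (Y u) / s x x * M x (Y u) $ k" for k
    proof -
      have "(\<Sum>i\<in>UNIV. \<Sum>j\<in>UNIV. (E x (dW j x) / s x x * M x (dW i x) $ k) * (u $ i * u $ j))
        = (\<Sum>j\<in>UNIV. \<Sum>i\<in>UNIV. (E x (dW j x) / s x x * M x (dW i x) $ k) * (u $ i * u $ j))"
        by (rule sum.swap)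
      also have "\<dots> = (\<Sum>i\<in>UNIV. \<Sum>j\<in>UNIV. (E x (dW i x) / s x x * M x (dW j x) $ k) * (u $ i * u $ j))"
        by (simp add: mult_ac)
      finally show ?thesis by (simp only: cross)
    qed
    have "L $ k = - (\<Sum>i\<in>UNIV. \<Sum>j\<in>UNIV. M x (ddW i j x) $ k * (u $ i * u $ j))
        + (\<Sum>i\<in>UNIV. \<Sum>j\<in>UNIV. (E x (dW i x) / s x x * M x (dW j x) $ k) * (u $ i * u $ j))
        + (\<Sum>i\<in>UNIV. \<Sum>j\<in>UNIV. (E x (dW j x) / s x x * M x (dW i x) $ k) * (u $ i * u $ j))" for k
      unfolding L_def dual_christoffel_lower_D vec_lambda_beta sum.distrib[symmetric] sum_negf[symmetric]
      by (intro sum.cong refl) (simp add: algebra_simps)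
    then have "L $ k = - M x (Q u) $ k + 2 * (E x (Y u) / s x x * M x (Y u) $ k)" for k
      unfolding cross cross'
      by (simp add: Q_def linear_sum[OF M_linear] linear_cmul[OF M_linear] mult.commute)
    then show ?thesis
      by (simp add: vec_eq_iff linear_diff[OF M_linear] linear_cmul[OF M_linear])
  qed
  have "(\<forall>k. a $ k + (\<Sum>i\<in>UNIV. \<Sum>j\<in>UNIV. dual_christoffel D x i j k * u $ i * u $ j) = 0)
      \<longleftrightarrow> a + transpose (matrix_inv g) *v L = 0"
    by (simp add: chr vec_eq_iff)
  also have "\<dots> \<longleftrightarrow> g *v (a + transpose (matrix_inv g) *v L) = 0"
    using g(1) by (metis div_metric_mult M_eq_0_iff dW_injective g_def matrix_vector_mult_0_right neg_equal_0_iff_equal)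
  also have "g *v (a + transpose (matrix_inv g) *v L) = g *v a + L"
  proof -
    have "g ** transpose (matrix_inv g) = transpose (matrix_inv g ** g)"
      by (simp add: matrix_transpose_mul g(2))
    then show ?thesis
      by (simp add: matrix_vector_right_distrib matrix_vector_mul_assoc gi
          del: transpose_matrix_vector)
  qed
  also have "g *v a = - M x (Y a)"
    by (simp add: g_def div_metric_mult jacobian_mult Y_def)
  also have "- M x (Y a) + L = - M x (Y a + Q u - (2 * E x (Y u) / s x x) *\<^sub>R Y u)"
    unfolding L by (simp add: linear_add[OF M_linear] linear_diff[OF M_linear])
  finally show ?thesis by (simp add: M_eq_0_iff jacobian_mult Y_def[symmetric] d2W_def Q_def[symmetric])
qed

end

section \<open>Dual geodesics are reparametrised segments\<close>

lemma has_vector_derivative_vec: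
  fixes F :: "real \<Rightarrow> real ^ 'k::finite"
  shows "(F has_vector_derivative d) (at t within S) \<longleftrightarrow>
    (\<forall>a. ((\<lambda>t. F t $ a) has_real_derivative d $ a) (at t within S))"
  unfolding has_vector_derivative_def has_field_derivative_def
  by (subst has_derivative_componentwise_within) (auto simp: Basis_vec_def inner_axis mult_commute_abs)

lemma partial_chain:
  fixes h :: "real ^ 'k::finite \<Rightarrow> real"
  assumes \<xi>: "(\<xi> has_vector_derivative u) (at t within S)"
    and h: "(h has_derivative (\<lambda>v. \<Sum>j\<in>UNIV. v $ j * c j)) (at (\<xi> t))"
  shows "((\<lambda>t. h (\<xi> t)) has_real_derivative (\<Sum>j\<in>UNIV. u $ j * c j)) (at t within S)"
proof -
  have "((\<lambda>t. h (\<xi> t)) has_derivative (\<lambda>r. \<Sum>j\<in>UNIV. (r *\<^sub>R u) $ j * c j)) (at t within S)"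
    by (rule has_derivative_compose[OF \<xi>[unfolded has_vector_derivative_def] h])
  moreover have "(\<Sum>j\<in>UNIV. (r *\<^sub>R u) $ j * c j) = (\<Sum>j\<in>UNIV. u $ j * c j) * r" for r
    by (simp add: sum_distrib_left mult_ac)
  ultimately show ?thesis by (simp only: has_field_derivative_def)
qed

context strictly_generated_portfolio
begin

lemma W_curve_derivative:
  assumes "(\<xi> has_vector_derivative u) (at t within S)"
  shows "((\<lambda>t. W (\<xi> t)) has_vector_derivative jacobian (\<xi> t) *v u) (at t within S)"
  unfolding has_vector_derivative_vec
  using partial_chain[OF assms W_has_derivative] by (simp add: jacobian_mult)

lemma W_curve_second_derivative:
  assumes \<xi>: "(\<xi> has_vector_derivative u t) (at t within S)" and u: "(u has_vector_derivative a) (at t within S)"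
  shows "((\<lambda>t. jacobian (\<xi> t) *v u t) has_vector_derivative jacobian (\<xi> t) *v a + d2W (\<xi> t) (u t)) (at t within S)"
  unfolding has_vector_derivative_vec
proof
  fix b
  have "((\<lambda>t. \<Sum>j\<in>UNIV. u t $ j * dW j (\<xi> t) $ b) has_real_derivative
      (\<Sum>j\<in>UNIV. a $ j * dW j (\<xi> t) $ b + (\<Sum>i\<in>UNIV. u t $ i * ddW i j (\<xi> t) $ b) * u t $ j)) (at t within S)"
    using u by (intro DERIV_sum DERIV_mult partial_chain[OF \<xi> dW_has_derivative]) (simp add: has_vector_derivative_vec)
  moreover have "(\<Sum>j\<in>UNIV. (\<Sum>i\<in>UNIV. u t $ i * ddW i j (\<xi> t) $ b) * u t $ j) = d2W (\<xi> t) (u t) $ b"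
    unfolding d2W_def sum_distrib_right by (subst sum.swap) (simp add: mult_ac)
  ultimately show "((\<lambda>t. (jacobian (\<xi> t) *v u t) $ b) has_real_derivative (jacobian (\<xi> t) *v a + d2W (\<xi> t) (u t)) $ b) (at t within S)"
    by (simp add: jacobian_mult sum.distrib)
qed

text \<open>
  This is the exponential of twice the \<open>c\<close>-transform of \<open>f\<close> at the dual coordinate. Its logarithmic
  derivative is the factor that relates the acceleration and the velocity of a dual geodesic in the
  coordinate \<open>W\<close>, so that such a curve moves along a straight line with a speed proportional to it.
\<close>
definition speed :: "real ^ 'm \<Rightarrow> real" where
  "speed x = (s x x * exp (- f x))\<^sup>2"

lemma speed_pos: "0 < speed x"
  using s_pos[of x x] by (simp add: speed_def)

lemma Ck_on_speed: "Ck_on k UNIV speed"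
  unfolding speed_def[abs_def] power2_eq_square
  by (intro Ck_on_mult Ck_on_s Ck_on_exp Ck_on_minus smooth_on_D[OF smooth_f])

text \<open>
  This is the envelope theorem: since the primal point minimises \<open>cost - f\<close> for its dual point, its own
  variation does not contribute to the derivative of the \<open>c\<close>-transform, and only that of \<open>W\<close> remains.
\<close>
lemma speed_curve_derivative:
  assumes \<xi>: "(\<xi> has_vector_derivative u) (at t within S)"
  shows "((\<lambda>t. speed (\<xi> t)) has_real_derivative
    speed (\<xi> t) * (2 * E (\<xi> t) (jacobian (\<xi> t) *v u) / s (\<xi> t) (\<xi> t))) (at t within S)"
proof -
  define x where "x = \<xi> t"
  define F where "F = (\<Sum>k\<in>UNIV. u $ k * partial k f x)"
  have \<xi>': "((\<lambda>t. \<xi> t $ a) has_real_derivative u $ a) (at t within S)" for a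
    using \<xi> by (simp add: has_vector_derivative_vec)
  have W': "((\<lambda>t. W (\<xi> t) $ a) has_real_derivative (jacobian x *v u) $ a) (at t within S)" for a
    using W_curve_derivative[OF \<xi>] by (simp add: has_vector_derivative_vec x_def)
  have exp': "((\<lambda>t. exp (g t)) has_real_derivative exp (g t) * d) (at t within S)"
    if "(g has_real_derivative d) (at t within S)" for g :: "real \<Rightarrow> real" and d
    by (rule DERIV_chain2[OF DERIV_exp that])
  have f': "((\<lambda>t. f (\<xi> t)) has_real_derivative F) (at t within S)"
    using partial_chain[OF \<xi> smooth_on_has_derivative[OF smooth_f]] by (simp add: F_def x_def)
  have "((\<lambda>t. s (\<xi> t) (\<xi> t)) has_real_derivative
      0 + (\<Sum>a\<in>UNIV. (jacobian x *v u) $ a * exp (\<xi> t $ a) + exp (\<xi> t $ a) * u $ a * W (\<xi> t) $ a)) (at t within S)"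
    unfolding s_def E_def by (intro DERIV_add DERIV_const DERIV_sum DERIV_mult W' exp' \<xi>')
  moreover have "(\<Sum>a\<in>UNIV. exp (\<xi> t $ a) * u $ a * W (\<xi> t) $ a) = s x x * F"
    unfolding F_def sum_distrib_left partial_f_W x_def[symmetric]
    using s_pos[of x x] by (intro sum.cong refl) (simp add: less_imp_neq[THEN not_sym])
  ultimately have s': "((\<lambda>t. s (\<xi> t) (\<xi> t)) has_real_derivative E x (jacobian x *v u) + s x x * F) (at t within S)"
    unfolding sum.distrib by (simp add: E_def x_def)
  have "((\<lambda>t. (s (\<xi> t) (\<xi> t) * exp (- f (\<xi> t))) * (s (\<xi> t) (\<xi> t) * exp (- f (\<xi> t)))) has_real_derivative
     ((E x (jacobian x *v u) + s x x * F) * exp (- f x) + exp (- f x) * - F * s x x) * (s x x * exp (- f x))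
     + ((E x (jacobian x *v u) + s x x * F) * exp (- f x) + exp (- f x) * - F * s x x) * (s x x * exp (- f x))) (at t within S)"
    unfolding x_def by (intro DERIV_mult s'[unfolded x_def] exp' DERIV_minus f')
  moreover have "((E x (jacobian x *v u) + s x x * F) * exp (- f x) + exp (- f x) * - F * s x x) * (s x x * exp (- f x))
     + ((E x (jacobian x *v u) + s x x * F) * exp (- f x) + exp (- f x) * - F * s x x) * (s x x * exp (- f x))
     = speed x * (2 * E x (jacobian x *v u) / s x x)"
    using s_pos[of x x] by (simp add: speed_def power2_eq_square field_simps)
  ultimately show ?thesis by (simp add: speed_def power2_eq_square x_def)
qed

text \<open>
  The equation of \<open>geodesic_equation_iff\<close> says that \<open>W'' = \<kappa> W'\<close>, and \<open>\<kappa>\<close> is the logarithmic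
  derivative of \<open>speed\<close> along the curve. Hence it says that \<open>W' / speed\<close> is constant.
\<close>
lemma dual_geodesic_coord_iff:
  assumes smooth: "smooth_on {0..1} \<xi>"
  shows "dual_geodesic_coord D \<xi> \<longleftrightarrow>
    (\<exists>c. \<forall>t\<in>{0..1}. ((\<lambda>t. W (\<xi> t)) has_vector_derivative speed (\<xi> t) *\<^sub>R c) (at t within {0..1}))"
proof -
  let ?I = "{0..1::real}"
  have "Ck_on (Suc (Suc 0)) ?I \<xi>" by (rule smooth_on_D[OF smooth])
  then obtain d where d: "\<And>t. t \<in> ?I \<Longrightarrow> (\<xi> has_derivative d t) (at t within ?I)"
    "\<And>v. Ck_on (Suc 0) ?I (\<lambda>t. d t v)" unfolding Ck_on.simps(2)[of "Suc 0"] by blast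
  define u where "u t = d t 1" for t
  have \<xi>: "(\<xi> has_vector_derivative u t) (at t within ?I)" if "t \<in> ?I" for t
  proof -
    have "d t r = r *\<^sub>R u t" for r
      using linear_cmul[OF bounded_linear.linear[OF has_derivative_bounded_linear[OF d(1)[OF that]]], of r 1]
      by (simp add: u_def)
    then have "d t = (\<lambda>r. r *\<^sub>R u t)" by auto
    with d(1)[OF that] show ?thesis by (simp add: has_vector_derivative_def)
  qed
  obtain e where e: "\<And>t. t \<in> ?I \<Longrightarrow> (u has_derivative e t) (at t within ?I)"
    using d(2)[of 1] unfolding u_def[abs_def] Ck_on.simps(2) by blast
  define a where "a t = e t 1" for t
  have u: "(u has_vector_derivative a t) (at t within ?I)" if "t \<in> ?I" for t
  proof -
    have "e t r = r *\<^sub>R a t" for r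
      using linear_cmul[OF bounded_linear.linear[OF has_derivative_bounded_linear[OF e[OF that]]], of r 1]
      by (simp add: a_def)
    then have "e t = (\<lambda>r. r *\<^sub>R a t)" by auto
    with e[OF that] show ?thesis by (simp add: has_vector_derivative_def)
  qed
  have vd: "vector_derivative F (at t within ?I) = F'"
    if "(F has_vector_derivative F') (at t within ?I)" "t \<in> ?I"
    for F :: "real \<Rightarrow> real ^ 'm" and F' and t :: real
    using that by (intro vector_derivative_within_closed_interval) auto
  have vu: "vector_derivative \<xi> (at t within ?I) = u t" if "t \<in> ?I" for t
    using vd[OF \<xi>[OF that] that] .
  have va: "vector_derivative (\<lambda>t. vector_derivative \<xi> (at t within ?I)) (at t within ?I) = a t" if "t \<in> ?I" for t
    by (rule vd[OF has_vector_derivative_transform[OF that vu u[OF that]] that]) simp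
  define Y where "Y t = jacobian (\<xi> t) *v u t" for t
  define \<kappa> where "\<kappa> t = 2 * E (\<xi> t) (Y t) / s (\<xi> t) (\<xi> t)" for t
  define Z where "Z t = jacobian (\<xi> t) *v a t + d2W (\<xi> t) (u t)" for t
  have W: "((\<lambda>t. W (\<xi> t)) has_vector_derivative Y t) (at t within ?I)" if "t \<in> ?I" for t
    unfolding Y_def by (rule W_curve_derivative[OF \<xi>[OF that]])
  have Y: "(Y has_vector_derivative Z t) (at t within ?I)" if "t \<in> ?I" for t
    unfolding Y_def[abs_def] Z_def by (rule W_curve_second_derivative[OF \<xi>[OF that] u[OF that]])
  have h: "((\<lambda>t. speed (\<xi> t)) has_real_derivative speed (\<xi> t) * \<kappa> t) (at t within ?I)" if "t \<in> ?I" for t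
    unfolding \<kappa>_def Y_def by (rule speed_curve_derivative[OF \<xi>[OF that]])
  have "dual_geodesic_coord D \<xi> \<longleftrightarrow> (\<forall>t\<in>?I. \<forall>k. a t $ k +
      (\<Sum>i\<in>UNIV. \<Sum>j\<in>UNIV. dual_christoffel D (\<xi> t) i j k * u t $ i * u t $ j) = 0)"
    unfolding dual_geodesic_coord_def Let_def using smooth by (simp add: vu va)
  also have "\<dots> \<longleftrightarrow> (\<forall>t\<in>?I. Z t = \<kappa> t *\<^sub>R Y t)"
    unfolding geodesic_equation_iff Z_def \<kappa>_def Y_def ..
  also have "\<dots> \<longleftrightarrow> (\<exists>c. \<forall>t\<in>?I. Y t = speed (\<xi> t) *\<^sub>R c)"
  proof
    assume eq: "\<forall>t\<in>?I. Z t = \<kappa> t *\<^sub>R Y t"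
    have "((\<lambda>t. inverse (speed (\<xi> t)) *\<^sub>R Y t) has_derivative (\<lambda>r. 0)) (at t within ?I)" if t: "t \<in> ?I" for t
    proof -
      have "((\<lambda>t. inverse (speed (\<xi> t))) has_real_derivative
          - (inverse (speed (\<xi> t)) * (speed (\<xi> t) * \<kappa> t) * inverse (speed (\<xi> t)))) (at t within ?I)"
        using speed_pos[of "\<xi> t"] by (intro DERIV_inverse' h[OF t]) simp
      note has_vector_derivative_scaleR[OF this Y[OF t]]
      moreover have "inverse (speed (\<xi> t)) * (speed (\<xi> t) * \<kappa> t) * inverse (speed (\<xi> t)) = inverse (speed (\<xi> t)) * \<kappa> t"
        using speed_pos[of "\<xi> t"] by simp
      ultimately show ?thesis
        using eq t by (simp add: has_vector_derivative_def)
    qed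
    then obtain c where c: "\<And>t. t \<in> ?I \<Longrightarrow> inverse (speed (\<xi> t)) *\<^sub>R Y t = c"
      using has_derivative_zero_constant[of ?I "\<lambda>t. inverse (speed (\<xi> t)) *\<^sub>R Y t"] by auto
    have "Y t = speed (\<xi> t) *\<^sub>R c" if "t \<in> ?I" for t
      using c[OF that, symmetric] speed_pos[of "\<xi> t"] by simp
    then show "\<exists>c. \<forall>t\<in>?I. Y t = speed (\<xi> t) *\<^sub>R c" by blast
  next
    assume "\<exists>c. \<forall>t\<in>?I. Y t = speed (\<xi> t) *\<^sub>R c"
    then obtain c where c: "\<And>t. t \<in> ?I \<Longrightarrow> Y t = speed (\<xi> t) *\<^sub>R c" by blast
    show "\<forall>t\<in>?I. Z t = \<kappa> t *\<^sub>R Y t"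
    proof
      fix t assume t: "t \<in> ?I"
      have "((\<lambda>t. speed (\<xi> t) *\<^sub>R c) has_vector_derivative \<kappa> t *\<^sub>R Y t) (at t within ?I)"
        using has_vector_derivative_scaleR[OF h[OF t] has_vector_derivative_const[of c]]
        by (simp add: c[OF t] mult.commute)
      then have "(Y has_vector_derivative \<kappa> t *\<^sub>R Y t) (at t within ?I)"
        using t c by (rule has_vector_derivative_transform[rotated 2])
      from vd[OF this t] vd[OF Y[OF t] t] show "Z t = \<kappa> t *\<^sub>R Y t" by simp
    qed
  qed
  also have "\<dots> \<longleftrightarrow> (\<exists>c. \<forall>t\<in>?I. ((\<lambda>t. W (\<xi> t)) has_vector_derivative speed (\<xi> t) *\<^sub>R c) (at t within ?I))"
    using W vd by (metis (no_types, lifting))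
  finally show ?thesis .
qed

text \<open>
  The velocity is a positive multiple of a fixed vector, so the curve \<open>W \<circ> \<xi>\<close> runs monotonically
  along a straight line between its end points.
\<close>
lemma dual_geodesic_trace:
  assumes geo: "dual_geodesic_coord D \<xi>"
  shows "(\<lambda>t. W (\<xi> t)) ` {0..1} = closed_segment (W (\<xi> 0)) (W (\<xi> 1))"
proof -
  let ?I = "{0..1::real}"
  have smooth: "smooth_on ?I \<xi>" using geo by (simp add: dual_geodesic_coord_def)
  obtain c where c: "\<And>t. t \<in> ?I \<Longrightarrow> ((\<lambda>t. W (\<xi> t)) has_vector_derivative speed (\<xi> t) *\<^sub>R c) (at t within ?I)"
    using geo unfolding dual_geodesic_coord_iff[OF smooth] by blast
  have "continuous_on ?I (\<lambda>t. speed (\<xi> t))"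
    by (rule continuous_on_compose2[OF Ck_on_imp_continuous_on[OF Ck_on_speed]
          Ck_on_imp_continuous_on[OF smooth_on_D[OF smooth]]]) simp
  then obtain \<tau> where \<tau>: "\<And>t. t \<in> ?I \<Longrightarrow> (\<tau> has_vector_derivative speed (\<xi> t)) (at t within ?I)"
    using antiderivative_continuous by blast
  have \<tau>_cont: "continuous_on ?I \<tau>"
    unfolding continuous_on_eq_continuous_within by (intro ballI has_vector_derivative_continuous[OF \<tau>])
  have \<tau>_at: "(\<tau> has_real_derivative speed (\<xi> t)) (at t)" if "0 < t" "t < 1" for t
    using \<tau>[of t] that at_within_interior[of t ?I]
    by (simp add: has_real_derivative_iff_has_vector_derivative)
  have mono: "\<tau> a < \<tau> b" if "0 \<le> a" "a < b" "b \<le> 1" for a b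
  proof (rule DERIV_pos_imp_increasing_open[OF that(2)])
    show "\<exists>y. DERIV \<tau> x :> y \<and> y > 0" if "a < x" "x < b" for x
      using \<tau>_at[of x] speed_pos[of "\<xi> x"] that \<open>0 \<le> a\<close> \<open>b \<le> 1\<close> by auto
    show "continuous_on {a..b} \<tau>" using \<tau>_cont that by (auto intro: continuous_on_subset)
  qed
  define L where "L = \<tau> 1 - \<tau> 0"
  have L: "0 < L" using mono[of 0 1] by (simp add: L_def)
  have "((\<lambda>t. W (\<xi> t) - \<tau> t *\<^sub>R c) has_derivative (\<lambda>r. 0)) (at t within ?I)" if t: "t \<in> ?I" for t
    using has_vector_derivative_diff[OF c[OF t] has_vector_derivative_scaleR[
        OF \<tau>[OF t, folded has_real_derivative_iff_has_vector_derivative] has_vector_derivative_const[of c]]]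
    by (simp add: has_vector_derivative_def)
  then obtain w where w: "\<And>t. t \<in> ?I \<Longrightarrow> W (\<xi> t) - \<tau> t *\<^sub>R c = w"
    using has_derivative_zero_constant[of ?I "\<lambda>t. W (\<xi> t) - \<tau> t *\<^sub>R c"] by auto
  have W: "W (\<xi> t) = w + \<tau> t *\<^sub>R c" if "t \<in> ?I" for t using w[OF that] by (simp add: algebra_simps)
  have seg: "W (\<xi> t) = (1 - (\<tau> t - \<tau> 0) / L) *\<^sub>R W (\<xi> 0) + ((\<tau> t - \<tau> 0) / L) *\<^sub>R W (\<xi> 1)" if "t \<in> ?I" for t
  proof -
    have "(1 - \<rho>) *\<^sub>R W (\<xi> 0) + \<rho> *\<^sub>R W (\<xi> 1) = w + (\<tau> 0 + \<rho> * (\<tau> 1 - \<tau> 0)) *\<^sub>R c" for \<rho>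
      by (simp add: W algebra_simps)
    then have "(1 - (\<tau> t - \<tau> 0) / L) *\<^sub>R W (\<xi> 0) + ((\<tau> t - \<tau> 0) / L) *\<^sub>R W (\<xi> 1)
        = w + (\<tau> 0 + (\<tau> t - \<tau> 0) / L * (\<tau> 1 - \<tau> 0)) *\<^sub>R c" .
    also have "\<tau> 0 + (\<tau> t - \<tau> 0) / L * (\<tau> 1 - \<tau> 0) = \<tau> t" using L by (simp add: L_def)
    finally show ?thesis using W[OF that] by simp
  qed
  show ?thesis
  proof (intro equalityI subsetI)
    fix y assume "y \<in> (\<lambda>t. W (\<xi> t)) ` ?I"
    then obtain t where t: "t \<in> ?I" "y = W (\<xi> t)" by blast
    have "0 \<le> (\<tau> t - \<tau> 0) / L" "(\<tau> t - \<tau> 0) / L \<le> 1"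
      using t(1) mono[of 0 t] mono[of t 1] L by (cases "t = 0"; cases "t = 1"; force simp: L_def)+
    then show "y \<in> closed_segment (W (\<xi> 0)) (W (\<xi> 1))"
      using seg[OF t(1)] t(2) by (auto simp: closed_segment_def)
  next
    fix y assume "y \<in> closed_segment (W (\<xi> 0)) (W (\<xi> 1))"
    then obtain r where r: "0 \<le> r" "r \<le> 1" "y = (1 - r) *\<^sub>R W (\<xi> 0) + r *\<^sub>R W (\<xi> 1)"
      by (auto simp: closed_segment_def)
    have "\<tau> 0 \<le> \<tau> 0 + r * L" "\<tau> 0 + r * L \<le> \<tau> 1"
    proof -
      have "0 \<le> r * L" "r * L \<le> L" using r L mult_right_mono[of r 1 L] by auto
      moreover have "\<tau> 1 = \<tau> 0 + L" by (simp add: L_def)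
      ultimately show "\<tau> 0 \<le> \<tau> 0 + r * L" "\<tau> 0 + r * L \<le> \<tau> 1" by linarith+
    qed
    then obtain t where t: "t \<in> ?I" "\<tau> t = \<tau> 0 + r * L"
      using IVT'[of \<tau> 0 "\<tau> 0 + r * L" 1] \<tau>_cont by auto
    then have "y = W (\<xi> t)" using seg[OF t(1)] L r by simp
    then show "y \<in> (\<lambda>t. W (\<xi> t)) ` ?I" using t by blast
  qed
qed

lemma W_has_derivative_jacobian: "(W has_derivative (\<lambda>v. jacobian x *v v)) (at x)"
  by (subst has_derivative_componentwise_within)
    (use W_has_derivative in \<open>auto simp: Basis_vec_def inner_axis jacobian_mult\<close>)

lemma inv_W: "inv W (W x) = x"
  by (rule inv_f_f[OF inj_W])

text \<open>
  The derivative of \<open>W\<close> is invertible by the strictness of the Hessian and \<open>W\<close> is injective, so the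
  inverse function theorem applies globally.
\<close>
lemma inv_W_has_derivative: "(inv W has_derivative (\<lambda>v. matrix_inv (jacobian x) *v v)) (at (W x))"
proof (rule has_derivative_inverse_strong[OF open_UNIV UNIV_I _ inv_W W_has_derivative_jacobian])
  show "continuous_on UNIV W"
    using W_has_derivative_jacobian by (auto simp: continuous_on_eq_continuous_at intro: has_derivative_continuous)
  show "(\<lambda>v. jacobian x *v v) \<circ> (\<lambda>v. matrix_inv (jacobian x) *v v) = id"
    by (simp add: fun_eq_iff matrix_vector_mul_assoc matrix_inv_works[OF invertible_jacobian])
qed

text \<open>
  Cramer's rule writes the inverse matrix as a rational function of the entries.
\<close>
lemma Ck_on_inverse_jacobian: "Ck_on k UNIV (\<lambda>x. matrix_inv (jacobian x) *v v)"
proof -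
  have det: "det (jacobian x) \<noteq> 0" for x using invertible_jacobian by (simp add: invertible_det_nz)
  have "jacobian x *v (matrix_inv (jacobian x) *v v) = v" for x
    by (simp add: matrix_vector_mul_assoc matrix_inv_works[OF invertible_jacobian])
  then have "matrix_inv (jacobian x) *v v = (\<chi> k. det (\<chi> i j. if j = k then v $ i else jacobian x $ i $ j) / det (jacobian x))" for x
    using cramer[OF det] by blast
  moreover have jacobian: "Ck_on k UNIV (\<lambda>x. jacobian x $ i $ j)" for i j
    using smooth_on_D[OF smooth_dW[of j i]] by (simp add: jacobian_def)
  have "Ck_on k UNIV (\<lambda>x. \<chi> l. det (\<chi> i j. if j = l then v $ i else jacobian x $ i $ j) / det (jacobian x))"
  proof (rule Ck_on_vec_lambda, rule Ck_on_divide)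
    show "Ck_on k UNIV (\<lambda>x. det (jacobian x))" by (rule Ck_on_det[OF jacobian])
    show "Ck_on k UNIV (\<lambda>x. det (\<chi> i j. if j = l then v $ i else jacobian x $ i $ j))" for l
    proof (rule Ck_on_det)
      show "Ck_on k UNIV (\<lambda>x. (\<chi> i j. if j = l then v $ i else jacobian x $ i $ j) $ i $ j)" for i j
        by (cases "j = l") (simp_all add: Ck_on_const jacobian)
    qed
  qed (rule det)
  ultimately show ?thesis by simp
qed

text \<open>
  On a given segment the equation of \<open>dual_geodesic_coord_iff\<close> separates: the inverse of the parameter
  change has the derivative \<open>1 / speed\<close> up to a constant. In the primal coordinate the resulting curve is an
  integral curve of a smooth vector field, whence its smoothness.
\<close>
lemma dual_geodesic_exists:
  assumes seg: "closed_segment A B \<subseteq> range W"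
  obtains \<xi> where "dual_geodesic_coord D \<xi>" and "W (\<xi> 0) = A" and "W (\<xi> 1) = B"
proof -
  let ?I = "{0..1::real}"
  \<comment> \<open>Clamping keeps \<open>P\<close> on the segment, so that the parameter change below is defined on both sides
    of the end points and has two-sided derivatives there.\<close>
  define P where "P r = A + max 0 (min 1 r) *\<^sub>R (B - A)" for r :: real
  define \<zeta> where "\<zeta> r = inv W (P r)" for r
  have "P r \<in> closed_segment A B" for r
    unfolding closed_segment_def P_def by (auto intro!: exI[of _ "max 0 (min 1 r)"] simp: algebra_simps)
  then have W\<zeta>: "W (\<zeta> r) = P r" for r
    using seg by (auto simp: \<zeta>_def intro!: f_inv_into_f)
  have P: "P r = A + r *\<^sub>R (B - A)" if "r \<in> ?I" for r using that by (simp add: P_def)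
  have "isCont \<zeta> r" for r
  proof -
    have "isCont (inv W) (P r)"
      unfolding W\<zeta>[symmetric] by (rule has_derivative_continuous[OF inv_W_has_derivative])
    moreover have "isCont P r" unfolding P_def[abs_def] by (intro continuous_intros)
    ultimately show ?thesis unfolding \<zeta>_def[abs_def] by (rule isCont_o2[rotated])
  qed
  then have "continuous_on UNIV (\<lambda>r. speed (\<zeta> r))"
    by (intro continuous_on_compose2[OF Ck_on_imp_continuous_on[OF Ck_on_speed]])
      (auto simp: continuous_on_eq_continuous_at)
  then have "continuous_on {-1..2} (\<lambda>r. 1 / speed (\<zeta> r))"
    using speed_pos by (intro continuous_intros) (auto intro: continuous_on_subset simp: less_imp_neq[THEN not_sym])
  then obtain \<sigma> where \<sigma>: "\<And>r. r \<in> {-1..2} \<Longrightarrow> (\<sigma> has_vector_derivative 1 / speed (\<zeta> r)) (at r within {-1..2})"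
    using antiderivative_continuous by blast
  have \<sigma>_at: "(\<sigma> has_real_derivative 1 / speed (\<zeta> r)) (at r)" if "-1 < r" "r < 2" for r
    using \<sigma>[of r] that at_within_interior[of r "{-1..2}"]
    by (simp add: has_real_derivative_iff_has_vector_derivative)
  have \<sigma>_cont: "continuous_on {-1..2} \<sigma>"
    unfolding continuous_on_eq_continuous_within by (intro ballI has_vector_derivative_continuous[OF \<sigma>])
  have mono: "\<sigma> a < \<sigma> b" if "-1 \<le> a" "a < b" "b \<le> 2" for a b
  proof (rule DERIV_pos_imp_increasing_open[OF that(2)])
    show "\<exists>y. DERIV \<sigma> x :> y \<and> y > 0" if "a < x" "x < b" for x
      using \<sigma>_at[of x] speed_pos[of "\<zeta> x"] that \<open>-1 \<le> a\<close> \<open>b \<le> 2\<close> by (intro exI[of _ "1 / speed (\<zeta> x)"]) auto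
    show "continuous_on {a..b} \<sigma>" using \<sigma>_cont that by (auto intro: continuous_on_subset)
  qed
  define g where "g = the_inv_into {-1..2} \<sigma>"
  have "inj_on \<sigma> {-1..2}"
    by (rule linorder_inj_onI) (use mono in force)+
  then have g: "g (\<sigma> r) = r" if "r \<in> {-1..2}" for r
    unfolding g_def using that by (rule the_inv_into_f_f)
  have g': "(g has_real_derivative speed (\<zeta> r)) (at (\<sigma> r))" if "-1 < r" "r < 2" for r
    unfolding has_field_derivative_def
  proof (rule has_derivative_inverse_strong[where S = "{-1<..<2}" and f = \<sigma>])
    show "continuous_on {-1<..<2} \<sigma>" using \<sigma>_cont by (auto intro: continuous_on_subset)
    show "(\<sigma> has_derivative (*) (1 / speed (\<zeta> r))) (at r)"
      using \<sigma>_at[OF that] by (simp add: has_field_derivative_def)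
    show "(*) (1 / speed (\<zeta> r)) \<circ> (*) (speed (\<zeta> r)) = id"
      using speed_pos[of "\<zeta> r"] by (auto simp: fun_eq_iff)
  qed (use that g in auto)
  define L where "L = \<sigma> 1 - \<sigma> 0"
  have L: "0 < L" using mono[of 0 1] by (simp add: L_def)
  define \<tau> where "\<tau> t = g (\<sigma> 0 + t * L)" for t
  have \<tau>: "\<tau> t \<in> ?I" "(\<tau> has_real_derivative L * speed (\<zeta> (\<tau> t))) (at t)" if t: "t \<in> ?I" for t
  proof -
    have "\<sigma> 0 \<le> \<sigma> 0 + t * L" "\<sigma> 0 + t * L \<le> \<sigma> 1"
    proof -
      have "0 \<le> t * L" "t * L \<le> L" using t L mult_right_mono[of t 1 L] by auto
      moreover have "\<sigma> 1 = \<sigma> 0 + L" by (simp add: L_def)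
      ultimately show "\<sigma> 0 \<le> \<sigma> 0 + t * L" "\<sigma> 0 + t * L \<le> \<sigma> 1" by linarith+
    qed
    moreover have "continuous_on ?I \<sigma>" using \<sigma>_cont by (auto intro: continuous_on_subset)
    ultimately obtain r where r: "r \<in> ?I" "\<sigma> r = \<sigma> 0 + t * L"
      using IVT'[of \<sigma> 0 "\<sigma> 0 + t * L" 1] by auto
    then have \<tau>r: "\<tau> t = r" using g[of r] by (simp add: \<tau>_def r(2)[symmetric])
    then show "\<tau> t \<in> ?I" using r by simp
    have "(g has_real_derivative speed (\<zeta> r)) (at (\<sigma> 0 + t * L))" using g'[of r] r by auto
    moreover have "((\<lambda>t. \<sigma> 0 + t * L) has_real_derivative L) (at t)"
      by (auto intro!: derivative_eq_intros)
    ultimately have "((\<lambda>t. g (\<sigma> 0 + t * L)) has_real_derivative speed (\<zeta> r) * L) (at t)" by (rule DERIV_chain2)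
    then show "(\<tau> has_real_derivative L * speed (\<zeta> (\<tau> t))) (at t)"
      by (simp add: \<tau>_def[abs_def, symmetric] \<tau>r mult.commute)
  qed
  have \<tau>01: "\<tau> 0 = 0" "\<tau> 1 = 1"
    using g[of 0] g[of 1] by (simp_all add: \<tau>_def L_def)
  define \<xi> where "\<xi> t = \<zeta> (\<tau> t)" for t
  define c where "c = L *\<^sub>R (B - A)"
  define X where "X x = speed x *\<^sub>R (matrix_inv (jacobian x) *v c)" for x
  have W\<xi>: "W (\<xi> t) = A + \<tau> t *\<^sub>R (B - A)" if "t \<in> ?I" for t
    using P[OF \<tau>(1)[OF that]] by (simp add: \<xi>_def W\<zeta>)
  have line: "((\<lambda>t. A + \<tau> t *\<^sub>R (B - A)) has_vector_derivative speed (\<xi> t) *\<^sub>R c) (at t within ?I)" if "t \<in> ?I" for t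
  proof -
    have "(\<tau> has_real_derivative L * speed (\<xi> t)) (at t within ?I)"
      unfolding \<xi>_def by (rule DERIV_subset[OF \<tau>(2)[OF that]]) simp
    from has_vector_derivative_add[OF has_vector_derivative_const
        has_vector_derivative_scaleR[OF this has_vector_derivative_const]]
    show ?thesis by (simp add: c_def mult.commute)
  qed
  then have W': "((\<lambda>t. W (\<xi> t)) has_vector_derivative speed (\<xi> t) *\<^sub>R c) (at t within ?I)" if "t \<in> ?I" for t
    using that W\<xi> by (intro has_vector_derivative_transform[OF that _ line]) auto
  have \<xi>': "(\<xi> has_derivative (\<lambda>r. r *\<^sub>R X (\<xi> t))) (at t within ?I)" if t: "t \<in> ?I" for t
  proof -
    have "((\<lambda>t. inv W (W (\<xi> t))) has_derivative (\<lambda>r. matrix_inv (jacobian (\<xi> t)) *v (r *\<^sub>R (speed (\<xi> t) *\<^sub>R c)))) (at t within ?I)"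
      by (rule has_derivative_compose[OF W'[OF t, unfolded has_vector_derivative_def] inv_W_has_derivative])
    then show ?thesis by (simp add: inv_W X_def matrix_vector_mult_scaleR)
  qed
  have X: "Ck_on k UNIV X" for k
    unfolding X_def[abs_def] by (intro Ck_on_scaleR Ck_on_speed Ck_on_inverse_jacobian)
  have "Ck_on k ?I \<xi>" for k
  proof (induction k)
    case 0
    have "continuous_on ?I \<xi>"
      unfolding continuous_on_eq_continuous_within by (intro ballI has_derivative_continuous[OF \<xi>'])
    then show ?case by simp
  next
    case (Suc k)
    have "Ck_on k ?I (\<lambda>t. X (\<xi> t))" by (rule Ck_on_compose[OF Suc.IH X]) simp
    then have "Ck_on k ?I (\<lambda>t. r *\<^sub>R X (\<xi> t))" for r by (rule Ck_on_scaleR[OF Ck_on_const])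
    with \<xi>' show ?case by (rule Ck_on_SucI)
  qed
  then have smooth: "smooth_on ?I \<xi>" by (simp add: smooth_on_def)
  show thesis
  proof (rule that)
    show "dual_geodesic_coord D \<xi>" unfolding dual_geodesic_coord_iff[OF smooth] using W' by blast
    show "W (\<xi> 0) = A" "W (\<xi> 1) = B" by (simp_all add: W\<xi> \<tau>01)
  qed
qed

end

section \<open>The displacement interpolation\<close>

context strictly_generated_portfolio
begin

lemma measurable_potential_interp: "potential (phi_interp \<phi> t) \<in> borel_measurable borel"
proof -
  have "Ck_on 0 UNIV (potential (phi_interp \<phi> t))"
    unfolding potential_phi_interp[abs_def]
    by (intro Ck_on_add Ck_on_mult Ck_on_sum Ck_on_const Ck_on_nth smooth_on_D[OF smooth_f])
  then show ?thesis by (intro borel_measurable_continuous_onI) simp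
qed

lemma W_eq_iff: "W x = W y \<longleftrightarrow> dual x = dual y"
  by (auto simp: W_def vec_eq_iff)

lemma dual_point_dual: "dual_point \<phi> (dual x) = expo_point x"
  unfolding dual_point_def
proof (rule the_inv_into_f_eq)
  show "inj_on (dual_coord \<phi>) prob_simplex"
  proof (rule inj_onI)
    fix p q assume p: "p \<in> prob_simplex" and q: "q \<in> prob_simplex"
      and "dual_coord \<phi> p = dual_coord \<phi> q"
    then have "W (expo_coord p) = W (expo_coord q)"
      by (simp add: dual_coord_def c_gradient_f W_eq_iff)
    then have "expo_coord p = expo_coord q" by (rule injD[OF inj_W])
    then show "p = q" using expo_point_expo_coord[OF p] expo_point_expo_coord[OF q] by metis
  qed
qed (simp_all add: dual_coord_def c_gradient_f)

definition mult_coord :: "real ^ 'm \<Rightarrow> real ^ 'm" where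
  "mult_coord \<eta> = (\<chi> a. exp (- (\<eta> $ a)))"

lemma W_eq_mult_coord: "W x = mult_coord (dual x)"
  by (simp add: W_def mult_coord_def)

lemma dual_point_eq:
  assumes "surj dual"
  shows "dual_point \<phi> \<eta> = expo_point (inv W (mult_coord \<eta>))"
proof -
  obtain x where "\<eta> = dual x" using assms by (metis surjD)
  then show ?thesis by (simp add: dual_point_dual inv_W flip: W_eq_mult_coord)
qed

lemma W_dual_point:
  assumes "surj dual"
  shows "W (expo_coord (dual_point \<phi> \<eta>)) = mult_coord \<eta>"
proof -
  obtain x where "\<eta> = dual x" using assms by (metis surjD)
  then show ?thesis by (simp add: dual_point_dual W_eq_mult_coord)
qed

text \<open>
  The weights \<open>exp (- \<theta>) \<pi>\<close> interpolate linearly; normalising their last entry to 1 is a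
  projective map, which keeps segments but changes the parameter.
\<close>
lemma mult_coord_flow:
  "(\<lambda>t. mult_coord (flow \<pi> t \<theta>)) ` {0..1} = closed_segment (mult_coord \<theta>) (mult_coord (flow \<pi> 1 \<theta>))"
proof -
  define N where "N = 1 / real CARD('m option)"
  define r where "r = \<pi> (expo_point \<theta>)"
  have N: "0 < N" by (simp add: N_def)
  have r: "0 < r $ j" for j unfolding r_def by (rule portfolio_pos) simp
  \<comment> \<open>\<open>d\<close> is the last weight of the interpolated portfolio, and \<open>u\<close> is the parameter on the segment
    that corresponds to the time \<open>t\<close> after division by \<open>d\<close>.\<close>
  define d where "d t = (1 - t) * N + t * r $ None" for t
  define u where "u t = t * r $ None / d t" for t
  have d: "0 < d t" if "t \<in> {0..1}" for t
  proof (cases "t = 0")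
    case True
    then show ?thesis using N by (simp add: d_def)
  next
    case False
    then show ?thesis using that N r[of None] unfolding d_def
      by (intro add_nonneg_pos mult_nonneg_nonneg mult_pos_pos) auto
  qed
  have nth: "mult_coord (flow \<pi> t \<theta>) $ a = exp (- (\<theta> $ a)) * (((1 - t) * N + t * r $ Some a) / d t)"
    if t: "t \<in> {0..1}" for t a
  proof -
    have "0 < portfolio_interp \<pi> t (expo_point \<theta>) $ j" for j
      by (intro prob_simplex_pos portfolio_interp_in_simplex interior expo_point_in_simplex t)
    then have pos: "0 < (1 - t) * N + t * r $ j" for j
      by (simp add: portfolio_interp_def N_def r_def)
    have "flow \<pi> t \<theta> $ a = \<theta> $ a - ln (((1 - t) * N + t * r $ Some a) / d t)"
      by (simp add: flow_def portfolio_interp_def N_def r_def d_def)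
    then have "mult_coord (flow \<pi> t \<theta>) $ a = exp (- (\<theta> $ a) + ln (((1 - t) * N + t * r $ Some a) / d t))"
      by (simp only: mult_coord_def vec_lambda_beta) simp
    moreover have "0 < ((1 - t) * N + t * r $ Some a) / d t"
      using pos[of "Some a"] d[OF t] by simp
    ultimately show ?thesis by (simp only: exp_add exp_ln)
  qed
  have seg: "mult_coord (flow \<pi> t \<theta>) = (1 - u t) *\<^sub>R mult_coord \<theta> + u t *\<^sub>R mult_coord (flow \<pi> 1 \<theta>)"
    if t: "t \<in> {0..1}" for t
  proof -
    have "((1 - t) * N + t * r $ Some a) / d t = (1 - u t) + u t * (r $ Some a / r $ None)" for a
    proof -
      have "1 - u t = (1 - t) * N / d t"
        using d[OF t] by (simp add: u_def field_simps) (simp add: d_def algebra_simps)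
      moreover have "u t * (r $ Some a / r $ None) = t * r $ Some a / d t"
        using r[of None] by (simp add: u_def)
      ultimately show ?thesis by (simp add: add_divide_distrib)
    qed
    moreover have "mult_coord (flow \<pi> 1 \<theta>) $ a = exp (- (\<theta> $ a)) * (r $ Some a / r $ None)" for a
      using nth[of 1 a] by (simp add: d_def)
    ultimately show ?thesis
      using nth[OF t] by (simp add: vec_eq_iff) (simp add: mult_coord_def algebra_simps)
  qed
  have onto: "\<exists>t\<in>{0..1}. u t = v" if v: "0 \<le> v" "v \<le> 1" for v
  proof -
    define e where "e = (1 - v) * r $ None + v * N"
    have e: "0 < e"
    proof (cases "v = 0")
      case True
      then show ?thesis using r by (simp add: e_def)
    next
      case False
      then show ?thesis using v N r[of None] unfolding e_def
        by (intro add_nonneg_pos mult_nonneg_nonneg mult_pos_pos) auto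
    qed
    \<comment> \<open>The solution of \<open>u t = v\<close>.\<close>
    define t where "t = v * N / e"
    have "t \<in> {0..1}"
      using v N r[of None] e by (simp add: t_def e_def)
    moreover have "u t = v"
    proof -
      have "1 - t = (1 - v) * r $ None / e" using e by (simp add: t_def field_simps) (simp add: e_def algebra_simps)
      then have "d t = (1 - v) * r $ None / e * N + v * N / e * r $ None"
        unfolding d_def by (simp only: t_def[symmetric])
      also have "\<dots> = r $ None * N / e"
        using e by (simp add: field_simps)
      finally have "d t = r $ None * N / e" .
      then show ?thesis using e N r[of None] by (simp add: u_def t_def)
    qed
    ultimately show ?thesis by blast
  qed
  show ?thesis
  proof (intro equalityI subsetI)
    fix y assume "y \<in> (\<lambda>t. mult_coord (flow \<pi> t \<theta>)) ` {0..1}"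
    then obtain t where t: "t \<in> {0..1}" "y = mult_coord (flow \<pi> t \<theta>)" by blast
    have "0 \<le> u t" "u t \<le> 1"
      using t(1) d[OF t(1)] r[of None] N by (simp_all add: u_def) (simp add: d_def)
    then show "y \<in> closed_segment (mult_coord \<theta>) (mult_coord (flow \<pi> 1 \<theta>))"
      using seg[OF t(1)] t(2) by (auto simp: closed_segment_def)
  next
    fix y assume "y \<in> closed_segment (mult_coord \<theta>) (mult_coord (flow \<pi> 1 \<theta>))"
    then obtain v where v: "0 \<le> v" "v \<le> 1" "y = (1 - v) *\<^sub>R mult_coord \<theta> + v *\<^sub>R mult_coord (flow \<pi> 1 \<theta>)"
      by (auto simp: closed_segment_def)
    then obtain t where t: "t \<in> {0..1}" "u t = v" using onto by blast
    have "y = mult_coord (flow \<pi> t \<theta>)" using seg[OF t(1)] v(3) t(2) by simp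
    then show "y \<in> (\<lambda>t. mult_coord (flow \<pi> t \<theta>)) ` {0..1}" using t(1) by blast
  qed
qed

text \<open>
  Both the trace of the flow and that of any dual geodesic between the two points are the image under
  \<open>expo_point \<circ> inv W\<close> of one and the same segment.
\<close>
lemma dual_geodesic_flow:
  fixes \<theta> :: "real ^ 'm"
  assumes surj: "surj dual"
  defines "joins \<equiv> \<lambda>\<gamma>. dual_geodesic \<phi> \<gamma> \<and> \<gamma> 0 = dual_point \<phi> \<theta> \<and> \<gamma> 1 = dual_point \<phi> (flow \<pi> 1 \<theta>)"
  shows "\<exists>\<gamma>. joins \<gamma>"
    and "joins \<gamma> \<Longrightarrow> \<gamma> ` {0..1} = (\<lambda>t. dual_point \<phi> (flow \<pi> t \<theta>)) ` {0..1}"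
proof -
  let ?A = "mult_coord \<theta>" and ?B = "mult_coord (flow \<pi> 1 \<theta>)"
  have "mult_coord \<eta> \<in> range W" for \<eta>
    using W_dual_point[OF surj, of \<eta>] by (metis rangeI)
  then have "closed_segment ?A ?B \<subseteq> range W"
    unfolding mult_coord_flow[symmetric] by blast
  then obtain \<xi> where \<xi>: "dual_geodesic_coord D \<xi>" "W (\<xi> 0) = ?A" "W (\<xi> 1) = ?B"
    by (rule dual_geodesic_exists)
  have "joins (\<lambda>t. expo_point (\<xi> t))"
    using \<xi> unfolding joins_def dual_geodesic_def dual_point_eq[OF surj]
    by (simp add: inv_W flip: \<xi>(2,3))
  then show "\<exists>\<gamma>. joins \<gamma>" by blast
  assume \<gamma>: "joins \<gamma>"
  define \<xi> where "\<xi> t = expo_coord (\<gamma> t)" for t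
  have geo: "dual_geodesic_coord D \<xi>" and in_S: "\<And>t. t \<in> {0..1} \<Longrightarrow> \<gamma> t \<in> prob_simplex"
    and ends: "W (\<xi> 0) = ?A" "W (\<xi> 1) = ?B"
    using \<gamma> by (auto simp: joins_def dual_geodesic_def \<xi>_def[abs_def] W_dual_point[OF surj])
  have "\<gamma> ` {0..1} = (\<lambda>w. expo_point (inv W w)) ` (\<lambda>t. W (\<xi> t)) ` {0..1}"
    unfolding image_image inv_W by (intro image_cong refl) (simp add: \<xi>_def expo_point_expo_coord in_S)
  also have "(\<lambda>t. W (\<xi> t)) ` {0..1} = (\<lambda>t. mult_coord (flow \<pi> t \<theta>)) ` {0..1}"
    unfolding dual_geodesic_trace[OF geo] mult_coord_flow ends ..
  finally show "\<gamma> ` {0..1} = (\<lambda>t. dual_point \<phi> (flow \<pi> t \<theta>)) ` {0..1}"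
    by (simp add: image_image dual_point_eq[OF surj])
qed

end

theorem theorem6p2:
  fixes P0 P1 :: "(real ^ 'm::finite) measure"
    and \<phi> :: "real ^ 'm option \<Rightarrow> real"
    and \<pi>1 :: "real ^ 'm option \<Rightarrow> real ^ 'm option"
  assumes "prob_space P0" and "sets P0 = sets borel"
    and "prob_space P1" and "sets P1 = sets borel"
    and "smooth_on prob_simplex \<phi>"
    and "exp_concave \<phi>"
    and "hessian_neg_def (\<lambda>p. exp (\<phi> p))"
    and "optimal_transport_map P0 P1 (c_gradient (potential \<phi>))"
    and "\<forall>p\<in>prob_simplex. \<pi>1 p \<in> prob_simplex"
    and "generates \<phi> \<pi>1"
  shows "c_concave (potential \<phi>)
    \<and> (\<forall>t\<in>{0..1}. generates (phi_interp \<phi> t) (portfolio_interp \<pi>1 t))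
    \<and> (\<forall>t\<in>{0..1}.
         let F = c_gradient (potential (phi_interp \<phi> t)); Pt = distr P0 borel F in
           (\<forall>\<theta>. \<exists>!\<eta>. is_c_gradient (potential (phi_interp \<phi> t)) \<theta> \<eta>) \<and>
           flow \<pi>1 t \<in> borel_measurable borel \<and>
           distr P0 borel (flow \<pi>1 t) = Pt \<and>
           optimal_transport_map P0 Pt F)
    \<and> (surj (c_gradient (potential \<phi>)) \<longrightarrow>
         (\<forall>\<theta>. let trace = (\<lambda>t. dual_point \<phi> (flow \<pi>1 t \<theta>)) ` {0..1};
                  joins = (\<lambda>\<gamma>. dual_geodesic \<phi> \<gamma> \<and> \<gamma> 0 = dual_point \<phi> \<theta> \<and>
                               \<gamma> 1 = dual_point \<phi> (flow \<pi>1 1 \<theta>))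
               in (\<exists>\<gamma>. joins \<gamma>) \<and> (\<forall>\<gamma>. joins \<gamma> \<longrightarrow> \<gamma> ` {0..1} = trace)))"
proof -
  interpret strictly_generated_portfolio \<phi> \<pi>1
    by unfold_locales (simp_all only: assms(5,7,9,10) bspec[OF assms(9)])
  have "c_concave f"
    using is_c_gradient_dual by (intro c_concave_if_c_gradient) blast
  moreover have "\<forall>t\<in>{0..1}. generates (phi_interp \<phi> t) (portfolio_interp \<pi>1 t)"
    using generates_interp[OF generated interior] by blast
  moreover have "\<forall>t\<in>{0..1}.
         let F = c_gradient (potential (phi_interp \<phi> t)); Pt = distr P0 borel F in
           (\<forall>\<theta>. \<exists>!\<eta>. is_c_gradient (potential (phi_interp \<phi> t)) \<theta> \<eta>) \<and>
           flow \<pi>1 t \<in> borel_measurable borel \<and>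
           distr P0 borel (flow \<pi>1 t) = Pt \<and>
           optimal_transport_map P0 Pt F"
  proof
    fix t :: real assume t: "t \<in> {0..1}"
    have F: "c_gradient (potential (phi_interp \<phi> t)) = flow \<pi>1 t"
      using c_gradient_interp(1)[OF t] by blast
    have "optimal_transport_map P0 (distr P0 borel (flow \<pi>1 t)) (flow \<pi>1 t)"
      by (rule optimal_transport_map_if_c_gradient[OF assms(1,2) flow_measurable[OF t]
            measurable_potential_interp c_gradient_interp(2)[OF t]])
    then show "let F = c_gradient (potential (phi_interp \<phi> t)); Pt = distr P0 borel F in
           (\<forall>\<theta>. \<exists>!\<eta>. is_c_gradient (potential (phi_interp \<phi> t)) \<theta> \<eta>) \<and>
           flow \<pi>1 t \<in> borel_measurable borel \<and>
           distr P0 borel (flow \<pi>1 t) = Pt \<and>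
           optimal_transport_map P0 Pt F"
      unfolding Let_def F using c_gradient_interp(1)[OF t] flow_measurable[OF t] by blast
  qed
  moreover have "surj (c_gradient f) \<longrightarrow>
         (\<forall>\<theta>. let trace = (\<lambda>t. dual_point \<phi> (flow \<pi>1 t \<theta>)) ` {0..1};
                  joins = (\<lambda>\<gamma>. dual_geodesic \<phi> \<gamma> \<and> \<gamma> 0 = dual_point \<phi> \<theta> \<and>
                               \<gamma> 1 = dual_point \<phi> (flow \<pi>1 1 \<theta>))
               in (\<exists>\<gamma>. joins \<gamma>) \<and> (\<forall>\<gamma>. joins \<gamma> \<longrightarrow> \<gamma> ` {0..1} = trace))"
    unfolding Let_def c_gradient_f by (intro impI allI conjI dual_geodesic_flow) simp_all
  ultimately show ?thesis by (intro conjI)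
qed

end
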